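(* Let $n_1\le n_2$, let $\Phi:\mathbb{R}^{n_1\times n_2}\to\mathbb{R}^m$ be a linear operator, and let $f:\mathbb{R}^m\to\mathbb{R}\cup\{\infty\}$ be a proper lower semicontinuous convex function that is twice continuously differentiable on $\operatorname{int}(\operatorname{dom} f)$ with $\nabla^2 f(y)$ positive definite for all $y\in\operatorname{int}(\operatorname{dom} f)$. Suppose that $\bar X\in\Phi^{-1}(\operatorname{int}(\operatorname{dom} f))$ is an optimal solution of $$\min_{X\in\mathbb{R}^{n_1\times n_2}}\ f(\Phi X)+\|X\|_*$$ and that, with $\bar Y:=-\Phi^*\nabla f(\Phi\bar X)$, the Nondegeneracy Condition $\bar Y\in\operatorname{ri}(\partial\|\bar X\|_* )$ holds. Then $\bar X$ is a tilt-stable solution of this problem if and only if it is the unique solution.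
   Context: $\mathbb{R}^{n_1\times n_2}$ carries the Frobenius inner product; $\|X\|_*$ is the nuclear norm (sum of singular values); $\partial$ is the convex subdifferential; $\operatorname{ri}$ is the relative interior; $\Phi^*$ is the adjoint of $\Phi$. The solution $\bar X$ is called tilt stable if the optimal solution set $$S(V):=\operatorname{argmin}\{f(\Phi X)+\|X\|_*-\langle V,X\rangle\mid X\in\mathbb{R}^{n_1\times n_2}\},\qquad V\in\mathbb{R}^{n_1\times n_2},$$ is single-valued and Lipschitz continuous around $0$ (i.e., on a neighborhood of $V=0$) with $S(0)=\{\bar X\}$. *)

theory Defs
  imports "HOL-Analysis.Analysis"
begin

section \<open>The nuclear norm\<close>

text \<open>
  Matrices with n1 rows and n2 columns are elements of \<open>real^'n2^'n1\<close>. The library's inner product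
  and norm on this type are the Frobenius ones.
\<close>

definition eigenspace :: "real^'n^'n \<Rightarrow> real \<Rightarrow> (real^'n) set" where
  "eigenspace A c = {v. A *v v = c *\<^sub>R v}"

text \<open>
  The singular values of \<open>X\<close> are the nonnegative square roots of the eigenvalues of \<open>X X\<^sup>T\<close>. As this
  matrix is symmetric, the multiplicity of an eigenvalue is the dimension of its eigenspace. For
  n1 \<open>\<le>\<close> n2 this gives exactly the n1 singular values of \<open>X\<close>; otherwise only additional zeros occur.
\<close>

definition singular_values :: "real^'n2^'n1 \<Rightarrow> real set" where
  "singular_values X = {s. 0 \<le> s \<and> eigenspace (X ** transpose X) (s\<^sup>2) \<noteq> {0}}"

definition singular_value_mult :: "real^'n2^'n1 \<Rightarrow> real \<Rightarrow> nat" where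
  "singular_value_mult X s = dim (eigenspace (X ** transpose X) (s\<^sup>2))"

definition nuclear_norm :: "real^'n2^'n1 \<Rightarrow> real" where
  "nuclear_norm X = (\<Sum>s\<in>singular_values X. real (singular_value_mult X s) * s)"

text \<open>The sum above ranges over a finite set.\<close>

lemma eigenspace_orthogonal:
  fixes A :: "real^'n^'n"
  assumes sym: "transpose A = A" and u: "u \<in> eigenspace A a" and v: "v \<in> eigenspace A b"
    and "a \<noteq> b"
  shows "u \<bullet> v = 0"
proof -
  have "(A *v u) \<bullet> v = u \<bullet> (A *v v)"
    by (metis dot_lmul_matrix sym transpose_matrix_vector)
  then have "a * (u \<bullet> v) = b * (u \<bullet> v)"
    using u v by (simp add: eigenspace_def)
  then show ?thesis using \<open>a \<noteq> b\<close> by simp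
qed

lemma finite_singular_values: "finite (singular_values (X :: real^'n2^'n1))"
proof -
  let ?A = "X ** transpose X"
  have sym: "transpose ?A = ?A"
    by (simp add: matrix_transpose_mul)
  have "\<exists>v. v \<in> eigenspace ?A (s\<^sup>2) \<and> v \<noteq> 0" if "s \<in> singular_values X" for s
  proof -
    have "0 \<in> eigenspace ?A (s\<^sup>2)" by (simp add: eigenspace_def)
    then show ?thesis using that by (auto simp: singular_values_def)
  qed
  then obtain v where v: "\<And>s. s \<in> singular_values X \<Longrightarrow> v s \<in> eigenspace ?A (s\<^sup>2) \<and> v s \<noteq> 0"
    by metis
  have orth: "v s \<bullet> v t = 0" if "s \<in> singular_values X" "t \<in> singular_values X" "s \<noteq> t" for s t
  proof -
    have "s\<^sup>2 \<noteq> t\<^sup>2" using that by (auto simp: singular_values_def)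
    then show ?thesis using eigenspace_orthogonal[OF sym] v that by blast
  qed
  have "inj_on v (singular_values X)"
    by (rule inj_onI) (metis orth v inner_eq_zero_iff)
  moreover have "pairwise orthogonal (v ` singular_values X)"
    unfolding pairwise_def orthogonal_def using orth by blast
  then have "independent (v ` singular_values X)"
    using v by (intro pairwise_orthogonal_independent) auto
  then have "finite (v ` singular_values X)"
    by (rule finiteI_independent)
  ultimately show ?thesis by (rule finite_imageD[rotated])
qed

section \<open>Convex analysis\<close>

text \<open>
  Functions with values in the reals extended by \<open>\<infinity>\<close> are modelled with type \<open>ereal\<close>;
  the value \<open>-\<infinity>\<close> is excluded by properness.
\<close>

definition edom :: "('a \<Rightarrow> ereal) \<Rightarrow> 'a set" where
  "edom f = {x. f x < \<infinity>}"

definition proper_fun :: "('a \<Rightarrow> ereal) \<Rightarrow> bool" where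
  "proper_fun f \<longleftrightarrow> (\<forall>x. f x \<noteq> -\<infinity>) \<and> edom f \<noteq> {}"

definition lsc_fun :: "('a::topological_space \<Rightarrow> ereal) \<Rightarrow> bool" where
  "lsc_fun f \<longleftrightarrow> (\<forall>x. f x \<le> Liminf (at x) f)"

definition convex_fun :: "('a::real_vector \<Rightarrow> ereal) \<Rightarrow> bool" where
  "convex_fun f \<longleftrightarrow> (\<forall>x y. \<forall>t::real. 0 < t \<and> t < 1 \<longrightarrow>
     f ((1 - t) *\<^sub>R x + t *\<^sub>R y) \<le> ereal (1 - t) * f x + ereal t * f y)"

definition subdifferential :: "('a::real_inner \<Rightarrow> real) \<Rightarrow> 'a \<Rightarrow> 'a set" where
  "subdifferential g x = {v. \<forall>z. g x + v \<bullet> (z - x) \<le> g z}"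

definition argmin :: "('a \<Rightarrow> ereal) \<Rightarrow> 'a set" where
  "argmin g = {x. is_arg_min g (\<lambda>_. True) x}"

section \<open>Derivatives\<close>

text \<open>
  For an extended-real-valued \<open>f\<close> these notions are applied to the real-valued function
  \<open>\<lambda>y. real_of_ereal (f y)\<close>, and only on the interior of \<open>edom f\<close>, where \<open>f\<close> is finite.
\<close>

definition gradient :: "('a::real_inner \<Rightarrow> real) \<Rightarrow> 'a \<Rightarrow> 'a" where
  "gradient g y = (THE D. GDERIV g y :> D)"

definition hessian :: "(real^'m \<Rightarrow> real) \<Rightarrow> real^'m \<Rightarrow> real^'m^'m" where
  "hessian g y = matrix (frechet_derivative (gradient g) (at y))"

definition twice_continuously_differentiable_on :: "(real^'m \<Rightarrow> real) \<Rightarrow> (real^'m) set \<Rightarrow> bool" where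
  "twice_continuously_differentiable_on g U \<longleftrightarrow>
     (\<forall>y\<in>U. g differentiable (at y)) \<and> (\<forall>y\<in>U. gradient g differentiable (at y)) \<and>
     continuous_on U (hessian g)"

definition positive_definite :: "real^'m^'m \<Rightarrow> bool" where
  "positive_definite H \<longleftrightarrow> transpose H = H \<and> (\<forall>v. v \<noteq> 0 \<longrightarrow> 0 < v \<bullet> (H *v v))"

section \<open>The optimization problem and tilt stability\<close>

definition objective :: "(real^'m \<Rightarrow> ereal) \<Rightarrow> (real^'n2^'n1 \<Rightarrow> real^'m) \<Rightarrow> real^'n2^'n1 \<Rightarrow> ereal" where
  "objective f \<Phi> X = f (\<Phi> X) + ereal (nuclear_norm X)"

definition tilted_solutions ::
  "(real^'m \<Rightarrow> ereal) \<Rightarrow> (real^'n2^'n1 \<Rightarrow> real^'m) \<Rightarrow> real^'n2^'n1 \<Rightarrow> (real^'n2^'n1) set" where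
  "tilted_solutions f \<Phi> V = argmin (\<lambda>X. objective f \<Phi> X - ereal (V \<bullet> X))"

definition tilt_stable ::
  "(real^'m \<Rightarrow> ereal) \<Rightarrow> (real^'n2^'n1 \<Rightarrow> real^'m) \<Rightarrow> real^'n2^'n1 \<Rightarrow> bool" where
  "tilt_stable f \<Phi> Xbar \<longleftrightarrow>
     tilted_solutions f \<Phi> 0 = {Xbar} \<and>
     (\<exists>U s L. open U \<and> 0 \<in> U \<and> (\<forall>V\<in>U. tilted_solutions f \<Phi> V = {s V}) \<and> L-lipschitz_on U s)"

end

theory Submission
  imports Defs
begin

text \<open>
  A tilt-stable solution is unique by definition, so the content is the converse. Write \<open>G\<close> for the
  nuclear norm and \<open>Y\<close> for the multiplier \<open>Ybar\<close>. The matrices \<open>X\<close> with \<open>Y \<in> \<partial>G X\<close> form the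
  normal cone at \<open>Y\<close> of the unit ball of the spectral norm; it consists of the products \<open>H Y\<close> with \<open>H\<close>
  positive semidefinite and \<open>Y Y\<^sup>T H = H\<close>, and its linear span is a space cut out by three linear
  equations (\<open>normal_cone_span\<close>). The proof compares this span with the kernel of \<open>\<Phi>\<close>.

  \<^bold>\<open>Uniqueness makes the two subspaces transversal.\<close> If \<open>Y\<close> is a relative interior point of
  \<open>\<partial>G Xbar\<close>, then the factor \<open>H\<close> of \<open>Xbar\<close> is positive definite on the eigenspace
  \<open>Y Y\<^sup>T e = e\<close> (\<open>nondegenerate_subgradient_kernel\<close>). Hence every \<open>W\<close> in the span is a
  feasible direction of the cone: \<open>Y \<in> \<partial>G (Xbar + t W)\<close> for some \<open>t > 0\<close>
  (\<open>nondegenerate_subgradient_persists\<close>). If moreover \<open>\<Phi> W = 0\<close>, then \<open>Xbar + t W\<close> has the same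
  objective value as \<open>Xbar\<close>, so uniqueness forces \<open>W = 0\<close>.

  \<^bold>\<open>Transversality gives a quantitative monotonicity estimate.\<close> Let \<open>Y\<^sub>i \<in> \<partial>G X\<^sub>i\<close> with \<open>Y\<^sub>1\<close>
  close to \<open>Y\<close> and \<open>X\<^sub>2\<close> bounded, and let \<open>m = \<langle>Y\<^sub>1 - Y\<^sub>2, X\<^sub>1 - X\<^sub>2\<rangle>\<close>, which is nonnegative. The equality cases of the duality
  between \<open>G\<close> and the spectral norm, in a quantitative form, show that \<open>X\<^sub>1 - X\<^sub>2\<close> solves the three equations
  of the span at \<open>Y\<^sub>1\<close> up to an error of order \<open>\<surd>m\<close> (\<open>subgradient_difference_near_span\<close>).
  As \<open>\<Phi>\<close> together with these equations is an injective linear map, it follows that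
  \<open>\<kappa> \<parallel>X\<^sub>1 - X\<^sub>2\<parallel>\<^sup>2 \<le> \<parallel>\<Phi> (X\<^sub>1 - X\<^sub>2)\<parallel>\<^sup>2 + m\<close> with some \<open>\<kappa> > 0\<close>
  (\<open>subgradient_monotonicity_modulus\<close>).

  \<^bold>\<open>The estimate gives Lipschitz continuity.\<close> Small tilts have minimizers, and all of them lie near \<open>Xbar\<close>
  (\<open>tilted_argmin_near\<close>). For minimizers \<open>X\<^sub>i\<close> of the tilts by \<open>V\<^sub>i\<close>, Fermat's rule yields the subgradients
  \<open>Y\<^sub>i = V\<^sub>i - \<Phi>\<^sup>* \<nabla>f (\<Phi> X\<^sub>i)\<close>. The positive definite Hessian makes \<open>\<nabla>f\<close> strongly monotone near \<open>\<Phi> Xbar\<close>,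
  which bounds \<open>\<parallel>\<Phi> (X\<^sub>1 - X\<^sub>2)\<parallel>\<^sup>2\<close>. Adding the two estimates, one obtains that a multiple of
  \<open>\<parallel>X\<^sub>1 - X\<^sub>2\<parallel>\<^sup>2\<close> is at most \<open>\<langle>V\<^sub>1 - V\<^sub>2, X\<^sub>1 - X\<^sub>2\<rangle>\<close>, and the Cauchy--Schwarz inequality concludes.
\<close>

section \<open>The Frobenius inner product and contractions\<close>

lemma norm_matrix_power2:
  fixes A :: "real^'n^'m"
  shows "(norm A)\<^sup>2 = (\<Sum>i\<in>UNIV. (norm (A $ i))\<^sup>2)"
  by (simp add: power2_norm_eq_inner inner_vec_def)

lemma norm_matrix_transpose [simp]:
  fixes A :: "real^'n^'m"
  shows "norm (transpose A) = norm A"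
proof -
  have "(norm (transpose A))\<^sup>2 = (\<Sum>i\<in>UNIV. \<Sum>j\<in>UNIV. A$j$i * A$j$i)"
    by (simp add: power2_norm_eq_inner inner_vec_def transpose_def)
  also have "\<dots> = (norm A)\<^sup>2"
    by (subst sum.swap) (simp add: power2_norm_eq_inner inner_vec_def)
  finally show ?thesis
    by (simp add: power2_eq_iff_nonneg)
qed

lemma inner_matrix_transpose:
  fixes A B :: "real^'n^'m"
  shows "transpose A \<bullet> transpose B = A \<bullet> B"
  unfolding inner_vec_def transpose_def by (simp, subst sum.swap, simp)

lemma transpose_add: "transpose (A + B) = transpose A + transpose (B :: real^'n^'m)"
  by (simp add: transpose_def vec_eq_iff)

lemma transpose_diff: "transpose (A - B) = transpose A - transpose (B :: real^'n^'m)"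
  by (simp add: transpose_def vec_eq_iff)

lemma inner_matrix_mult_left:
  fixes A :: "real^'k^'m" and B :: "real^'n^'k"
  shows "(A ** B) \<bullet> C = B \<bullet> (transpose A ** C)"
proof -
  have "(A ** B) \<bullet> C = (\<Sum>i\<in>UNIV. \<Sum>j\<in>UNIV. \<Sum>k\<in>UNIV. A$i$k * B$k$j * C$i$j)"
    by (simp add: inner_vec_def matrix_matrix_mult_def sum_distrib_right)
  also have "\<dots> = (\<Sum>i\<in>UNIV. \<Sum>k\<in>UNIV. \<Sum>j\<in>UNIV. A$i$k * B$k$j * C$i$j)"
    by (intro sum.cong refl sum.swap)
  also have "\<dots> = (\<Sum>k\<in>UNIV. \<Sum>i\<in>UNIV. \<Sum>j\<in>UNIV. A$i$k * B$k$j * C$i$j)"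
    by (rule sum.swap)
  also have "\<dots> = (\<Sum>k\<in>UNIV. \<Sum>j\<in>UNIV. \<Sum>i\<in>UNIV. A$i$k * B$k$j * C$i$j)"
    by (intro sum.cong refl sum.swap)
  also have "\<dots> = B \<bullet> (transpose A ** C)"
    by (simp add: inner_vec_def matrix_matrix_mult_def transpose_def sum_distrib_left mult_ac)
  finally show ?thesis .
qed

lemma inner_matrix_mult_right:
  fixes A :: "real^'k^'m" and B :: "real^'n^'k"
  shows "(A ** B) \<bullet> C = A \<bullet> (C ** transpose B)"
proof -
  have "(A ** B) \<bullet> C = (transpose B ** transpose A) \<bullet> transpose C"
    by (metis inner_matrix_transpose matrix_transpose_mul)
  also have "\<dots> = transpose A \<bullet> transpose (C ** transpose B)"
    by (simp add: inner_matrix_mult_left matrix_transpose_mul)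
  finally show ?thesis
    by (simp add: inner_matrix_transpose)
qed

lemma inner_matrix_vector_mult:
  fixes A :: "real^'n^'m"
  shows "(A *v x) \<bullet> y = x \<bullet> (transpose A *v y)"
  by (metis dot_lmul_matrix inner_commute transpose_matrix_vector)

lemma norm_matrix_vector_mult_le:
  fixes A :: "real^'n^'m"
  shows "norm (A *v x) \<le> norm A * norm x"
proof (rule power2_le_imp_le)
  have "(norm (A *v x))\<^sup>2 = (\<Sum>i\<in>UNIV. (A $ i \<bullet> x)\<^sup>2)"
    by (simp add: power2_norm_eq_inner inner_vec_def[of "A *v x"] matrix_vector_mul_component)
      (simp add: power2_eq_square)
  also have "\<dots> \<le> (\<Sum>i\<in>UNIV. (norm (A $ i))\<^sup>2 * (norm x)\<^sup>2)"
    by (intro sum_mono) (metis Cauchy_Schwarz_ineq power2_norm_eq_inner)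
  also have "\<dots> = (norm A * norm x)\<^sup>2"
    by (simp add: norm_matrix_power2 power_mult_distrib sum_distrib_right)
  finally show "(norm (A *v x))\<^sup>2 \<le> (norm A * norm x)\<^sup>2" .
qed simp

lemma matrix_mult_row: "(A ** B) $ i = transpose B *v (A $ i)" for A :: "real^'k^'m"
  by (simp add: matrix_matrix_mult_def matrix_vector_mult_def transpose_def vec_eq_iff mult.commute)

lemma norm_matrix_mult_le:
  fixes A :: "real^'k^'m" and B :: "real^'n^'k"
  shows "norm (A ** B) \<le> norm A * norm B"
proof (rule power2_le_imp_le)
  have "(norm (A ** B))\<^sup>2 = (\<Sum>i\<in>UNIV. (norm (transpose B *v (A $ i)))\<^sup>2)"
    by (simp add: norm_matrix_power2 matrix_mult_row)
  also have "\<dots> \<le> (\<Sum>i\<in>UNIV. (norm (A $ i) * norm B)\<^sup>2)"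
    by (intro sum_mono power_mono)
      (metis norm_matrix_transpose norm_matrix_vector_mult_le mult.commute, simp)
  also have "\<dots> = (norm A * norm B)\<^sup>2"
    by (simp add: norm_matrix_power2 power_mult_distrib sum_distrib_right)
  finally show "(norm (A ** B))\<^sup>2 \<le> (norm A * norm B)\<^sup>2" .
qed simp

lemma bounded_bilinear_matrix_mult:
  "bounded_bilinear ((**) :: real^'k^'m \<Rightarrow> real^'n^'k \<Rightarrow> real^'n^'m)"
proof
  show "\<exists>K. \<forall>A B. norm (A ** B :: real^'n^'m) \<le> norm (A :: real^'k^'m) * norm B * K"
    by (rule exI[of _ 1]) (simp add: norm_matrix_mult_le)
qed (simp_all add: matrix_matrix_mult_def vec_eq_iff sum.distrib algebra_simps sum_distrib_left)

lemmas matrix_mult_add_left = bounded_bilinear.add_left[OF bounded_bilinear_matrix_mult]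
  and matrix_mult_add_right = bounded_bilinear.add_right[OF bounded_bilinear_matrix_mult]
  and matrix_mult_diff_left = bounded_bilinear.diff_left[OF bounded_bilinear_matrix_mult]
  and matrix_mult_diff_right = bounded_bilinear.diff_right[OF bounded_bilinear_matrix_mult]
  and matrix_mult_scaleR_left = bounded_bilinear.scaleR_left[OF bounded_bilinear_matrix_mult]
  and matrix_mult_scaleR_right = bounded_bilinear.scaleR_right[OF bounded_bilinear_matrix_mult]

text \<open>
  The unit ball of the spectral norm, which is dual to the nuclear norm.
\<close>

definition contraction :: "real^'n^'m \<Rightarrow> bool" where
  "contraction Y \<longleftrightarrow> (\<forall>v. norm (Y *v v) \<le> norm v)"

lemma contraction_transpose:
  assumes "contraction Y"
  shows "contraction (transpose Y)"
  unfolding contraction_def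
proof
  fix v
  let ?w = "transpose Y *v v"
  have "(norm ?w)\<^sup>2 = v \<bullet> (Y *v ?w)"
    by (metis inner_commute inner_matrix_vector_mult power2_norm_eq_inner)
  also have "\<dots> \<le> norm v * norm (Y *v ?w)"
    by (rule norm_cauchy_schwarz)
  also have "\<dots> \<le> norm v * norm ?w"
    using assms by (auto simp: contraction_def intro: mult_left_mono)
  finally show "norm ?w \<le> norm v"
    by (metis mult_right_le_imp_le norm_ge_zero norm_le_zero_iff order_le_less power2_eq_square)
qed

text \<open>
  A product with a contraction does not increase the Frobenius norm either, since the contraction acts on each
  row separately.
\<close>

lemma norm_mult_contraction_le:
  fixes A :: "real^'k^'m" and Y :: "real^'n^'k"
  assumes "contraction Y"
  shows "norm (A ** Y) \<le> norm A"
proof (rule power2_le_imp_le)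
  have "(norm (A ** Y))\<^sup>2 = (\<Sum>i\<in>UNIV. (norm (transpose Y *v (A $ i)))\<^sup>2)"
    by (simp add: norm_matrix_power2 matrix_mult_row)
  also have "\<dots> \<le> (\<Sum>i\<in>UNIV. (norm (A $ i))\<^sup>2)"
    using contraction_transpose[OF assms] by (intro sum_mono power_mono) (simp_all add: contraction_def)
  also have "\<dots> = (norm A)\<^sup>2"
    by (simp add: norm_matrix_power2)
  finally show "(norm (A ** Y))\<^sup>2 \<le> (norm A)\<^sup>2" .
qed simp

lemma norm_contraction_mult_le:
  fixes A :: "real^'n^'k" and Y :: "real^'k^'m"
  assumes "contraction Y"
  shows "norm (Y ** A) \<le> norm A"
  using norm_mult_contraction_le[OF contraction_transpose[OF assms], of "transpose A"]
  by (metis matrix_transpose_mul norm_matrix_transpose)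

text \<open>
  The equality case of the Cauchy--Schwarz inequality. Subgradients of a dual norm are maximizers of a linear
  functional over contractions, and this lemma turns such a maximality into matrix equations.
\<close>

lemma eq_if_inner_ge_power2:
  fixes x y :: "'a::real_inner"
  assumes "norm x \<le> c" "norm y \<le> c" "c\<^sup>2 \<le> x \<bullet> y"
  shows "x = y" "norm x = c"
proof -
  have "(norm x)\<^sup>2 \<le> c\<^sup>2" "(norm y)\<^sup>2 \<le> c\<^sup>2"
    using assms by (auto intro: power_mono)
  moreover have "(norm (x - y))\<^sup>2 = (norm x)\<^sup>2 + (norm y)\<^sup>2 - 2 * (x \<bullet> y)"
    by (simp add: power2_norm_eq_inner inner_diff inner_commute)
  ultimately have "(norm (x - y))\<^sup>2 \<le> 0"
    using assms(3) by simp
  then show "x = y" by simp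
  then have "c\<^sup>2 \<le> (norm x)\<^sup>2"
    using assms(3) by (simp add: power2_norm_eq_inner)
  then show "norm x = c"
    using assms(1) power2_le_imp_le[of c "norm x"] by simp
qed

section \<open>The spectral theorem for symmetric real matrices\<close>

text \<open>
  A maximizer \<open>u\<close> of the Rayleigh quotient over the invariant subspace \<open>S\<close> is an eigenvector: the quadratic form
  \<open>q x = c \<parallel>x\<parallel>\<^sup>2 - \<langle>x, f x\<rangle>\<close> is nonnegative on \<open>S\<close> and vanishes at \<open>u\<close>, so its derivative at
  \<open>u\<close> in the direction \<open>w = c u - f u\<close>, which is \<open>2 \<parallel>w\<parallel>\<^sup>2\<close>, has to vanish as well.
\<close>

lemma selfadjoint_eigenvector:
  fixes f :: "'a::euclidean_space \<Rightarrow> 'a"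
  assumes f: "linear f" and sym: "\<And>x y. f x \<bullet> y = x \<bullet> f y"
    and S: "subspace S" "f ` S \<subseteq> S" and nz: "S \<noteq> {0}"
  obtains u c where "u \<in> S" "norm u = 1" "f u = c *\<^sub>R u"
proof -
  interpret f: linear f by (fact f)
  let ?K = "S \<inter> sphere 0 1"
  obtain w where w: "w \<in> S" "w \<noteq> 0"
    using nz subspace_0[OF S(1)] by blast
  then have "w /\<^sub>R norm w \<in> ?K"
    using S(1) by (auto simp: subspace_scale)
  moreover have "compact ?K"
    by (intro closed_Int_compact closed_subspace S(1)) simp
  moreover have "continuous_on ?K (\<lambda>x. x \<bullet> f x)"
    using f by (intro continuous_intros linear_continuous_on linear_linear[THEN iffD1])
      (simp add: linear_conv_bounded_linear)
  ultimately obtain u where u: "u \<in> ?K" and max: "\<And>x. x \<in> ?K \<Longrightarrow> x \<bullet> f x \<le> u \<bullet> f u"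
    using continuous_attains_sup[of ?K "\<lambda>x. x \<bullet> f x"] by blast
  define c where "c = u \<bullet> f u"
  define q where "q x = c * (x \<bullet> x) - x \<bullet> f x" for x
  have q_nonneg: "0 \<le> q x" if "x \<in> S" for x
  proof (cases "x = 0")
    case False
    have "x /\<^sub>R norm x \<in> ?K"
      using that False S(1) by (auto simp: subspace_scale)
    from max[OF this] have "(x \<bullet> f x) / (norm x)\<^sup>2 \<le> c"
      by (simp add: f.scaleR c_def power2_eq_square divide_inverse mult_ac)
    then show ?thesis
      using False by (simp add: q_def divide_simps power2_norm_eq_inner)
  qed (simp add: q_def f.zero)
  define w where "w = c *\<^sub>R u - f u"
  have "w \<in> S"
    using u S by (auto simp: w_def intro!: subspace_diff subspace_scale)
  have uu: "u \<bullet> u = 1"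
    using u by (simp add: norm_eq_1)
  have expand: "q (u + t *\<^sub>R w) = 2 * t * (w \<bullet> w) + t\<^sup>2 * q w" for t
  proof -
    have "w \<bullet> f u = u \<bullet> f w"
      using sym[of u w] by (simp add: inner_commute)
    then have "q (u + t *\<^sub>R w) = q u + 2 * t * (c * (w \<bullet> u) - w \<bullet> f u) + t\<^sup>2 * q w"
      by (simp add: q_def f.add f.scaleR inner_add inner_commute algebra_simps power2_eq_square)
    moreover have "q u = 0"
      by (simp add: q_def uu c_def)
    moreover have "c * (w \<bullet> u) - w \<bullet> f u = w \<bullet> w"
      by (simp add: w_def inner_diff algebra_simps)
    ultimately show ?thesis by simp
  qed
  have "w \<bullet> w = 0"
  proof (rule ccontr)
    assume "w \<bullet> w \<noteq> 0"
    then have ww: "0 < w \<bullet> w" by simp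
    have qw: "0 \<le> q w" by (rule q_nonneg) fact
    \<comment> \<open>This value of \<open>t\<close> makes the linear term of the expansion dominate the quadratic one.\<close>
    define t where "t = - (w \<bullet> w) / (q w + 1)"
    have "u + t *\<^sub>R w \<in> S"
      using u \<open>w \<in> S\<close> S(1) by (auto intro: subspace_add subspace_scale)
    then have "0 \<le> 2 * t * (w \<bullet> w) + t\<^sup>2 * q w"
      using q_nonneg expand by metis
    also have "\<dots> \<le> 2 * t * (w \<bullet> w) + t\<^sup>2 * (q w + 1)"
      by (simp add: mult_left_mono)
    also have "\<dots> = - ((w \<bullet> w)\<^sup>2 / (q w + 1))"
      using qw by (simp add: t_def divide_simps power2_eq_square) 
    also have "\<dots> < 0"
      using ww qw by simp
    finally show False by simp
  qed
  then have "f u = c *\<^sub>R u" by (simp add: w_def)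
  then show ?thesis using that u by auto
qed

text \<open>
  The orthogonal complement in \<open>S\<close> of an eigenvector of a self-adjoint map is again invariant and has a smaller
  dimension.
\<close>

lemma selfadjoint_orthonormal_eigenbasis:
  fixes f :: "'a::euclidean_space \<Rightarrow> 'a"
  assumes f: "linear f" and sym: "\<And>x y. f x \<bullet> y = x \<bullet> f y"
  shows "subspace S \<Longrightarrow> f ` S \<subseteq> S \<Longrightarrow>
    \<exists>B. B \<subseteq> S \<and> pairwise orthogonal B \<and> (\<forall>b\<in>B. norm b = 1 \<and> (\<exists>c. f b = c *\<^sub>R b)) \<and> span B = S"
proof (induction "dim S" arbitrary: S rule: less_induct)
  case less
  show ?case
  proof (cases "S = {0}")
    case True
    then show ?thesis by (intro exI[of _ "{}"]) auto
  next
    case False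
    obtain u c where u: "u \<in> S" "norm u = 1" "f u = c *\<^sub>R u"
      using selfadjoint_eigenvector[OF f sym less.prems False] by blast
    have uu: "u \<bullet> u = 1"
      using u(2) norm_eq_1 by blast
    define T where "T = {x\<in>S. u \<bullet> x = 0}"
    have T: "subspace T"
      using less.prems(1) by (auto simp: T_def subspace_def inner_add)
    have "u \<bullet> f x = c * (u \<bullet> x)" for x
      using sym[of u x] by (simp add: u(3))
    then have fT: "f ` T \<subseteq> T"
      using less.prems(2) by (auto simp: T_def)
    have "u \<notin> T"
      by (simp add: T_def uu)
    then have "T \<subset> S"
      using u(1) T_def by blast
    moreover have "span T = T" "span S = S"
      using T less.prems(1) span_eq_iff by blast+
    ultimately have "dim T < dim S"
      using dim_psubset[of T S] by metis
    from less.hyps[OF this T fT] obtain B where B: "B \<subseteq> T" "pairwise orthogonal B"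
      "\<forall>b\<in>B. norm b = 1 \<and> (\<exists>c. f b = c *\<^sub>R b)" "span B = T"
      by (elim exE conjE)
    have "S \<subseteq> span (insert u B)"
    proof
      fix x assume "x \<in> S"
      then have "x - (u \<bullet> x) *\<^sub>R u \<in> T"
        using u(1) uu less.prems(1)
        by (simp add: T_def inner_diff_right subspace_diff subspace_scale)
      then show "x \<in> span (insert u B)"
        using B(4) by (auto simp: span_insert)
    qed
    moreover have "span (insert u B) \<subseteq> S"
      using u(1) B(1) less.prems(1) by (intro span_minimal) (auto simp: T_def)
    moreover have "pairwise orthogonal (insert u B)"
      using B(1,2) by (auto simp: pairwise_insert T_def orthogonal_def inner_commute)
    ultimately show ?thesis
      using u B(1,3) by (intro exI[of _ "insert u B"]) (auto simp: T_def)
  qed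
qed

definition diagonal :: "('n \<Rightarrow> real) \<Rightarrow> real^'n^'n" where
  "diagonal d = (\<chi> i j. if i = j then d i else 0)"

lemma diagonal_mult: "diagonal d ** diagonal e = diagonal (\<lambda>i. d i * e i)"
  by (simp add: diagonal_def matrix_matrix_mult_def vec_eq_iff mult_delta_left)

lemma diagonal_vector_mult: "diagonal d *v x = (\<chi> i. d i * x $ i)"
  by (simp add: diagonal_def matrix_vector_mult_def vec_eq_iff mult_delta_left)

lemma transpose_diagonal [simp]: "transpose (diagonal d) = diagonal d"
  by (auto simp: diagonal_def transpose_def vec_eq_iff)

theorem spectral_decomposition:
  fixes A :: "real^'n^'n"
  assumes "transpose A = A"
  obtains Q d where "orthogonal_matrix Q" "A = Q ** diagonal d ** transpose Q"
proof -
  have sym: "(A *v x) \<bullet> y = x \<bullet> (A *v y)" for x y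
    by (metis assms dot_lmul_matrix transpose_matrix_vector)
  obtain B where B: "pairwise orthogonal B" "\<And>b. b \<in> B \<Longrightarrow> norm b = 1"
    "\<And>b. b \<in> B \<Longrightarrow> \<exists>c. A *v b = c *\<^sub>R b" "span B = UNIV"
    using selfadjoint_orthonormal_eigenbasis[OF matrix_vector_mul_linear[of A] sym subspace_UNIV]
    by fastforce
  have "0 \<notin> B" using B(2) by force
  then have "independent B"
    using B(1) by (rule pairwise_orthogonal_independent[rotated])
  then have "card B = dim (span B)"
    by (simp add: dim_eq_card_independent)
  then have "card B = CARD('n)"
    by (simp add: B(4) del: dim_span)
  moreover have "finite B"
    using \<open>independent B\<close> by (rule finiteI_independent)
  ultimately obtain v where v: "bij_betw v (UNIV :: 'n set) B"
    by (metis finite_class.finite_UNIV finite_same_card_bij)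
  then have vB: "v i \<in> B" for i
    by (auto simp: bij_betw_def)
  obtain d where d: "\<And>i. A *v v i = d i *\<^sub>R v i"
    using B(3)[OF vB] by metis
  define Q where "Q = (\<chi> i j. v j $ i)"
  have col: "column j Q = v j" for j
    by (simp add: Q_def column_def)
  have "orthogonal (v i) (v j)" if "i \<noteq> j" for i j
    using B(1) vB bij_betw_imp_inj_on[OF v] that by (metis pairwise_def injD)
  then have Q: "orthogonal_matrix Q"
    using B(2)[OF vB] by (simp add: orthogonal_matrix_orthonormal_columns col)
  have "(A ** Q) $ i $ j = (Q ** diagonal d) $ i $ j" for i j
  proof -
    have "(A ** Q) $ i $ j = (A *v v j) $ i"
      by (simp add: matrix_matrix_mult_def matrix_vector_mult_def Q_def)
    also have "\<dots> = (Q ** diagonal d) $ i $ j"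
      by (simp add: d matrix_matrix_mult_def diagonal_def Q_def mult_delta_right mult.commute)
    finally show ?thesis .
  qed
  then have "A ** Q = Q ** diagonal d"
    by (simp add: vec_eq_iff)
  then have "A = Q ** diagonal d ** transpose Q"
    using Q by (metis matrix_mul_assoc matrix_mul_rid orthogonal_matrix_def)
  with Q show ?thesis by (rule that)
qed

section \<open>The nuclear norm as a dual norm\<close>

text \<open>
  The orthogonal matrix \<open>Q\<close> carries the coordinate subspace on which \<open>diagonal d\<close> acts as multiplication by \<open>c\<close>
  onto the eigenspace.
\<close>

lemma dim_eigenspace:
  fixes A :: "real^'n^'n"
  assumes Q: "orthogonal_matrix Q" and A: "A = Q ** diagonal d ** transpose Q"
  shows "dim (eigenspace A c) = card {i. d i = c}"
proof -
  have QQ: "transpose Q ** Q = mat 1" "Q ** transpose Q = mat 1"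
    using Q by (simp_all add: orthogonal_matrix_def)
  let ?E = "{x :: real^'n. \<forall>i. i \<notin> {i. d i = c} \<longrightarrow> x $ i = 0}"
  have D: "diagonal d *v x = c *\<^sub>R x \<longleftrightarrow> x \<in> ?E" for x
    by (auto simp: diagonal_vector_mult vec_eq_iff)
  have "eigenspace A c = (*v) Q ` ?E"
  proof (intro set_eqI iffI)
    fix v assume "v \<in> eigenspace A c"
    then have "A *v v = c *\<^sub>R v" by (simp add: eigenspace_def)
    then have "transpose Q *v (A *v v) = c *\<^sub>R (transpose Q *v v)"
      by (simp only: matrix_vector_mult_scaleR)
    then have "diagonal d *v (transpose Q *v v) = c *\<^sub>R (transpose Q *v v)"
      by (simp only: A matrix_vector_mul_assoc matrix_mul_assoc QQ matrix_mul_lid)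
    then have "transpose Q *v v \<in> ?E" using D by blast
    moreover have "v = Q *v (transpose Q *v v)"
      by (simp only: matrix_vector_mul_assoc QQ matrix_vector_mul_lid)
    ultimately show "v \<in> (*v) Q ` ?E" by blast
  next
    fix v assume "v \<in> (*v) Q ` ?E"
    then obtain x where x: "v = Q *v x" "x \<in> ?E" by blast
    have "A *v v = Q *v (diagonal d *v ((transpose Q ** Q) *v x))"
      by (simp only: A x(1) matrix_vector_mul_assoc matrix_mul_assoc)
    also have "\<dots> = c *\<^sub>R v"
      using D[THEN iffD2, OF x(2)] x(1) by (simp only: QQ matrix_vector_mul_lid matrix_vector_mult_scaleR)
    finally show "v \<in> eigenspace A c" by (simp add: eigenspace_def)
  qed
  moreover have "inj ((*v) Q)"
    using QQ(1) matrix_left_invertible_injective by blast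
  ultimately have "dim (eigenspace A c) = dim ?E"
    using dim_image_eq[of "(*v) Q" ?E] by (simp add: inj_on_subset)
  also have "\<dots> = card {i. d i = c}"
    using dim_substandard_cart[where 'a=real, of "{i. d i = c}"] by (simp add: dim_vec_eq)
  finally show ?thesis .
qed

text \<open>
  Counting each singular value with the dimension of its eigenspace amounts to summing the square roots of the
  diagonal entries of any orthogonal diagonalization of \<open>X X\<^sup>T\<close>.
\<close>

lemma nuclear_norm_eq_sum:
  fixes X :: "real^'n2^'n1"
  assumes Q: "orthogonal_matrix Q" and s: "\<And>i. 0 \<le> s i"
    and X: "X ** transpose X = Q ** diagonal (\<lambda>i. (s i)\<^sup>2) ** transpose Q"
  shows "nuclear_norm X = (\<Sum>i\<in>UNIV. s i)"
proof -
  have sq: "(s i)\<^sup>2 = t\<^sup>2 \<longleftrightarrow> s i = t" if "0 \<le> t" for i t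
    using s[of i] that by (simp add: power2_eq_iff_nonneg)
  have mult: "singular_value_mult X t = card {i. s i = t}" if "0 \<le> t" for t
    using dim_eigenspace[OF Q X] sq[OF that] by (simp add: singular_value_mult_def)
  have "singular_values X = range s"
  proof (intro set_eqI iffI)
    fix t assume t: "t \<in> singular_values X"
    then have "0 \<le> t" "eigenspace (X ** transpose X) (t\<^sup>2) \<noteq> {0}"
      by (auto simp: singular_values_def)
    moreover have "0 \<in> eigenspace (X ** transpose X) (t\<^sup>2)"
      by (simp add: eigenspace_def)
    ultimately have "dim (eigenspace (X ** transpose X) (t\<^sup>2)) \<noteq> 0"
      using dim_eq_0[of "eigenspace (X ** transpose X) (t\<^sup>2)"] by blast
    then have "card {i. s i = t} \<noteq> 0"
      using mult[OF \<open>0 \<le> t\<close>] unfolding singular_value_mult_def by metis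
    then show "t \<in> range s"
      by (metis (mono_tags, lifting) card.empty empty_Collect_eq rangeI)
  next
    fix t assume "t \<in> range s"
    then have t: "0 \<le> t" "{i. s i = t} \<noteq> {}"
      using s by auto
    then have "dim (eigenspace (X ** transpose X) (t\<^sup>2)) \<noteq> 0"
      using mult[OF t(1)] by (simp add: singular_value_mult_def)
    then have "eigenspace (X ** transpose X) (t\<^sup>2) \<noteq> {0}" by auto
    then show "t \<in> singular_values X"
      using t(1) by (simp add: singular_values_def)
  qed
  then have "nuclear_norm X = (\<Sum>t\<in>range s. real (card {i. s i = t}) * t)"
    using s by (auto simp: nuclear_norm_def mult intro!: sum.cong)
  also have "\<dots> = (\<Sum>t\<in>range s. \<Sum>i\<in>{i\<in>UNIV. s i = t}. s i)"
    by (intro sum.cong refl) simp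
  also have "\<dots> = (\<Sum>i\<in>UNIV. s i)"
    by (rule sum.group) auto
  finally show ?thesis .
qed

lemma norm_orthogonal_mult_diagonal:
  assumes "orthogonal_matrix Q"
  shows "(norm (Q ** diagonal d))\<^sup>2 = (\<Sum>i\<in>UNIV. (d i)\<^sup>2)"
proof -
  have "(norm (Q ** diagonal d))\<^sup>2 = (Q ** diagonal d) \<bullet> (Q ** diagonal d)"
    by (rule power2_norm_eq_inner)
  also have "\<dots> = diagonal d \<bullet> (transpose Q ** Q ** diagonal d)"
    by (simp only: inner_matrix_mult_left matrix_mul_assoc)
  also have "\<dots> = diagonal d \<bullet> diagonal d"
    using assms by (simp add: orthogonal_matrix_def)
  also have "\<dots> = (\<Sum>i\<in>UNIV. (d i)\<^sup>2)"
    by (simp add: inner_vec_def diagonal_def power2_eq_square mult_delta_left)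
  finally show ?thesis .
qed

text \<open>
  The polar decomposition \<open>X = R R\<^sup>T Y\<close>: the positive factor \<open>R R\<^sup>T\<close> is the square root of
  \<open>X X\<^sup>T\<close>, whose trace \<open>\<parallel>R\<parallel>\<^sup>2\<close> is the nuclear norm. The condition \<open>Y Y\<^sup>T R = R\<close>
  makes \<open>Y\<^sup>T\<close> isometric on the range of \<open>R\<close>. The whole duality theory of the nuclear norm below rests
  on this factorization.
\<close>

lemma polar_decomposition:
  fixes X :: "real^'n2^'n1"
  obtains R :: "real^'n1^'n1" and Y where
    "contraction Y" "X = R ** transpose R ** Y" "Y ** transpose Y ** R = R"
    "nuclear_norm X = (norm R)\<^sup>2"
proof -
  obtain Q d where Q: "orthogonal_matrix Q" and XX: "X ** transpose X = Q ** diagonal d ** transpose Q"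
    using spectral_decomposition[of "X ** transpose X"] by (metis matrix_transpose_mul transpose_transpose)
  have QQ: "transpose Q ** Q = mat 1" "Q ** transpose Q = mat 1"
    using Q by (simp_all add: orthogonal_matrix_def)
  define Z where "Z = transpose Q ** X"
  have ZZ: "Z ** transpose Z = diagonal d"
  proof -
    have "Z ** transpose Z = transpose Q ** (X ** transpose X) ** Q"
      by (simp only: Z_def matrix_transpose_mul transpose_transpose matrix_mul_assoc)
    also have "\<dots> = (transpose Q ** Q) ** diagonal d ** (transpose Q ** Q)"
      by (simp only: XX matrix_mul_assoc)
    finally show ?thesis by (simp add: QQ)
  qed
  have X: "X = Q ** Z"
    by (simp only: Z_def matrix_mul_assoc QQ matrix_mul_lid)
  have row: "d i = Z $ i \<bullet> Z $ i" for i
  proof -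
    have "(Z ** transpose Z) $ i $ i = Z $ i \<bullet> Z $ i"
      by (simp add: matrix_mult_transpose_dot_row row_def)
    then show ?thesis by (simp add: ZZ diagonal_def)
  qed
  then have d: "0 \<le> d i" for i by simp
  define s where "s i = sqrt (d i)" for i
  \<comment> \<open>The entries \<open>inverse (s i)\<close> vanish for \<open>s i = 0\<close>, so \<open>Y Y\<^sup>T\<close> is the projection onto the range of \<open>X\<close>.\<close>
  define p where "p i = (if d i = 0 then 0 else 1::real)" for i
  have s: "0 \<le> s i" "(s i)\<^sup>2 = d i" for i
    using d by (auto simp: s_def)
  define R where "R = Q ** diagonal (\<lambda>i. sqrt (s i))"
  define Y where "Y = Q ** diagonal (\<lambda>i. inverse (s i)) ** Z"
  have "R ** transpose R = Q ** (diagonal (\<lambda>i. sqrt (s i)) ** diagonal (\<lambda>i. sqrt (s i))) ** transpose Q"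
    by (simp only: R_def matrix_transpose_mul transpose_diagonal matrix_mul_assoc)
  then have RR: "R ** transpose R = Q ** diagonal s ** transpose Q"
    using s(1) by (simp add: diagonal_mult)
  have "Y ** transpose Y = Q ** (diagonal (\<lambda>i. inverse (s i)) ** (Z ** transpose Z) **
      diagonal (\<lambda>i. inverse (s i))) ** transpose Q"
    by (simp only: Y_def matrix_transpose_mul transpose_diagonal matrix_mul_assoc)
  moreover have "inverse (s i) * d i * inverse (s i) = p i" for i
    using s(2)[of i, symmetric] by (auto simp: p_def power2_eq_square field_simps)
  ultimately have YY: "Y ** transpose Y = Q ** diagonal p ** transpose Q"
    by (simp add: ZZ diagonal_mult)
  have "Y ** transpose Y ** R = Q ** diagonal p ** (transpose Q ** Q) ** diagonal (\<lambda>i. sqrt (s i))"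
    by (simp only: YY R_def matrix_mul_assoc)
  also have "\<dots> = Q ** (diagonal p ** diagonal (\<lambda>i. sqrt (s i)))"
    by (simp add: QQ matrix_mul_assoc)
  also have "\<dots> = R"
  proof -
    have *: "p i * sqrt (s i) = sqrt (s i)" for i
      by (simp add: p_def s_def)
    show ?thesis by (simp only: diagonal_mult R_def *)
  qed
  finally have YYR: "Y ** transpose Y ** R = R" .
  have pZ: "diagonal p ** Z = Z"
  proof -
    have "(diagonal p ** Z) $ i $ j = Z $ i $ j" for i j
      using row[of i] by (cases "d i = 0")
        (auto simp: matrix_matrix_mult_def diagonal_def mult_delta_left p_def)
    then show ?thesis by (simp add: vec_eq_iff)
  qed
  have "R ** transpose R ** Y = Q ** diagonal s ** (transpose Q ** Q) ** diagonal (\<lambda>i. inverse (s i)) ** Z"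
    by (simp only: RR Y_def matrix_mul_assoc)
  also have "\<dots> = Q ** (diagonal s ** diagonal (\<lambda>i. inverse (s i)) ** Z)"
    by (simp add: QQ matrix_mul_assoc)
  also have "diagonal s ** diagonal (\<lambda>i. inverse (s i)) = diagonal p"
  proof -
    have *: "s i * inverse (s i) = p i" for i
      by (auto simp: p_def s_def)
    show ?thesis by (simp only: diagonal_mult *)
  qed
  finally have X_eq: "X = R ** transpose R ** Y"
    by (simp add: pZ X)
  have "norm (transpose Y *v v) \<le> norm v" for v
  proof (rule power2_le_imp_le)
    let ?w = "transpose Q *v v"
    have "(norm (transpose Y *v v))\<^sup>2 = v \<bullet> (Y *v (transpose Y *v v))"
      by (metis power2_norm_eq_inner inner_matrix_vector_mult transpose_transpose)
    also have "\<dots> = v \<bullet> (Q *v (diagonal p *v ?w))"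
      by (simp only: matrix_vector_mul_assoc YY matrix_mul_assoc)
    also have "\<dots> = ?w \<bullet> (diagonal p *v ?w)"
      by (metis inner_matrix_vector_mult transpose_transpose)
    also have "\<dots> \<le> ?w \<bullet> ?w"
      unfolding inner_vec_def by (intro sum_mono) (auto simp: diagonal_vector_mult p_def)
    also have "\<dots> = v \<bullet> ((Q ** transpose Q) *v v)"
      by (metis inner_matrix_vector_mult transpose_transpose matrix_vector_mul_assoc)
    finally show "(norm (transpose Y *v v))\<^sup>2 \<le> (norm v)\<^sup>2"
      by (simp add: QQ power2_norm_eq_inner)
  qed simp
  then have "contraction (transpose Y)"
    unfolding contraction_def by blast
  then have "contraction Y"
    using contraction_transpose by fastforce
  moreover have "nuclear_norm X = (norm R)\<^sup>2"
  proof -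
    have "nuclear_norm X = (\<Sum>i\<in>UNIV. s i)"
      using Q XX s by (intro nuclear_norm_eq_sum[of Q]) simp_all
    then show ?thesis
      using s(1) by (simp add: R_def norm_orthogonal_mult_diagonal[OF Q])
  qed
  ultimately show ?thesis
    using that X_eq YYR by blast
qed

lemma inner_gram:
  fixes R :: "real^'k^'m" and Y Z :: "real^'n^'m"
  shows "Z \<bullet> (R ** transpose R ** Y) = (transpose R ** Z) \<bullet> (transpose R ** Y)"
  by (metis inner_commute inner_matrix_mult_left matrix_mul_assoc)

text \<open>
  In \<open>\<langle>R\<^sup>T Z, R\<^sup>T Y\<rangle>\<close> both factors have norm at most \<open>\<parallel>R\<parallel>\<close>. Applied to a polar decomposition,
  this is the inequality \<open>\<langle>Z, X\<rangle> \<le> G X\<close> of the duality between nuclear and spectral norm.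
\<close>

lemma inner_gram_le:
  fixes R :: "real^'k^'m" and Y Z :: "real^'n^'m"
  assumes "contraction Y" "contraction Z"
  shows "Z \<bullet> (R ** transpose R ** Y) \<le> (norm R)\<^sup>2"
proof -
  have "Z \<bullet> (R ** transpose R ** Y) \<le> norm (transpose R ** Z) * norm (transpose R ** Y)"
    unfolding inner_gram by (rule norm_cauchy_schwarz)
  also have "\<dots> \<le> norm R * norm R"
    using norm_mult_contraction_le[of _ "transpose R"] assms
    by (intro mult_mono) (auto simp: norm_matrix_transpose)
  finally show ?thesis by (simp add: power2_eq_square)
qed

lemma inner_contraction_le_nuclear_norm:
  assumes "contraction Z"
  shows "Z \<bullet> X \<le> nuclear_norm X"
  by (metis polar_decomposition inner_gram_le assms)

lemma nuclear_norm_attained: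
  fixes X :: "real^'n2^'n1"
  obtains Y where "contraction Y" "Y \<bullet> X = nuclear_norm X"
proof -
  obtain R :: "real^'n1^'n1" and Y where *: "contraction Y" "X = R ** transpose R ** Y"
    "Y ** transpose Y ** R = R" "nuclear_norm X = (norm R)\<^sup>2"
    by (rule polar_decomposition)
  have "X \<bullet> Y = (R ** transpose R) \<bullet> (Y ** transpose Y)"
    by (metis *(2) inner_matrix_mult_right)
  also have "\<dots> = R \<bullet> (Y ** transpose Y ** R)"
    by (simp add: inner_matrix_mult_right)
  also have "\<dots> = nuclear_norm X"
    by (simp add: *(3,4) power2_norm_eq_inner)
  finally show ?thesis
    using that[OF *(1)] by (simp add: inner_commute)
qed

lemma nuclear_norm_gram_le:
  fixes R :: "real^'k^'n1" and Y :: "real^'n2^'n1"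
  assumes "contraction Y"
  shows "nuclear_norm (R ** transpose R ** Y) \<le> (norm R)\<^sup>2"
  by (metis nuclear_norm_attained inner_gram_le assms)

lemma nuclear_norm_scaleR:
  assumes "0 \<le> c"
  shows "nuclear_norm (c *\<^sub>R X) = c * nuclear_norm X"
proof (rule antisym)
  show "nuclear_norm (c *\<^sub>R X) \<le> c * nuclear_norm X"
    by (metis nuclear_norm_attained inner_contraction_le_nuclear_norm inner_scaleR_right mult_left_mono assms)
  show "c * nuclear_norm X \<le> nuclear_norm (c *\<^sub>R X)"
    by (metis nuclear_norm_attained inner_contraction_le_nuclear_norm inner_scaleR_right)
qed

lemma convex_nuclear_norm: "convex_on UNIV (nuclear_norm :: real^'n2^'n1 \<Rightarrow> real)"
proof (rule convex_onI)
  fix t :: real and X Z :: "real^'n2^'n1"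
  assume t: "0 < t" "t < 1"
  obtain Y where Y: "contraction Y"
    "Y \<bullet> ((1 - t) *\<^sub>R X + t *\<^sub>R Z) = nuclear_norm ((1 - t) *\<^sub>R X + t *\<^sub>R Z)"
    by (rule nuclear_norm_attained)
  have "(1 - t) * (Y \<bullet> X) + t * (Y \<bullet> Z) \<le> (1 - t) * nuclear_norm X + t * nuclear_norm Z"
    using t inner_contraction_le_nuclear_norm[OF Y(1)] by (intro add_mono mult_left_mono) auto
  then show "nuclear_norm ((1 - t) *\<^sub>R X + t *\<^sub>R Z) \<le> (1 - t) * nuclear_norm X + t * nuclear_norm Z"
    by (simp add: Y(2)[symmetric] inner_add_right)
qed simp

lemma continuous_nuclear_norm: "continuous_on S (nuclear_norm :: real^'n2^'n1 \<Rightarrow> real)"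
  using continuous_on_subset[OF convex_on_continuous[OF open_UNIV convex_nuclear_norm]] by blast

section \<open>Subgradients of the nuclear norm\<close>

text \<open>
  Positive homogeneity of \<open>G\<close> splits the subgradient inequality into \<open>\<langle>Y, X\<rangle> = G X\<close> and
  \<open>\<langle>Y, Z\<rangle> \<le> G Z\<close> for all \<open>Z\<close>. Testing the latter with the rank-one matrix \<open>Z = (Y v) v\<^sup>T\<close>, for which
  \<open>G Z \<le> \<parallel>Y v\<parallel> \<parallel>v\<parallel>\<close>, shows that \<open>Y\<close> is a contraction.
\<close>

lemma subdifferential_nuclear_norm_iff:
  "Y \<in> subdifferential nuclear_norm X \<longleftrightarrow> contraction Y \<and> Y \<bullet> X = nuclear_norm X"
proof
  assume "contraction Y \<and> Y \<bullet> X = nuclear_norm X"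
  then show "Y \<in> subdifferential nuclear_norm X"
    using inner_contraction_le_nuclear_norm[of Y] by (auto simp: subdifferential_def inner_diff_right)
next
  assume "Y \<in> subdifferential nuclear_norm X"
  then have sub: "nuclear_norm X + Y \<bullet> (Z - X) \<le> nuclear_norm Z" for Z
    by (simp add: subdifferential_def)
  have "Y \<bullet> X = nuclear_norm X"
    using sub[of "2 *\<^sub>R X"] sub[of "0 *\<^sub>R X"] nuclear_norm_scaleR[of 2 X] nuclear_norm_scaleR[of 0 X]
    by (simp add: scaleR_2 inner_diff_right)
  then have le: "Y \<bullet> Z \<le> nuclear_norm Z" for Z
    using sub[of Z] by (simp add: inner_diff_right)
  have "norm (Y *v v) \<le> norm v" for v
  proof -
    define U where "U = (\<chi> i j. (Y *v v) $ i * v $ j)"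
    have U: "Z \<bullet> U = (Y *v v) \<bullet> (Z *v v)" for Z
      by (simp add: U_def inner_vec_def matrix_vector_mult_def sum_distrib_left sum_distrib_right mult_ac)
    obtain Z where Z: "contraction Z" "Z \<bullet> U = nuclear_norm U"
      by (rule nuclear_norm_attained)
    have "(norm (Y *v v))\<^sup>2 = Y \<bullet> U"
      by (simp add: U power2_norm_eq_inner)
    also have "\<dots> \<le> (Y *v v) \<bullet> (Z *v v)"
      using le[of U] Z(2) by (simp add: U)
    also have "\<dots> \<le> norm (Y *v v) * norm (Z *v v)"
      by (rule norm_cauchy_schwarz)
    also have "\<dots> \<le> norm (Y *v v) * norm v"
      using Z(1) by (auto simp: contraction_def intro: mult_left_mono)
    finally show ?thesis
      by (metis mult_left_le_imp_le norm_ge_zero norm_le_zero_iff order_le_less power2_eq_square)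
  qed
  with \<open>Y \<bullet> X = nuclear_norm X\<close> show "contraction Y \<and> Y \<bullet> X = nuclear_norm X"
    by (simp add: contraction_def)
qed

text \<open>
  Any subgradient can serve as the contraction of a polar decomposition: the pairing of \<open>R\<^sup>T Y\<close>
  with \<open>R\<^sup>T Z\<close>, for \<open>Z\<close> the factor of some polar decomposition, attains the Cauchy--Schwarz bound
  \<open>\<parallel>R\<parallel>\<^sup>2\<close>, so both agree.
\<close>

lemma subgradient_factorization:
  fixes X Y :: "real^'n2^'n1"
  assumes "Y \<in> subdifferential nuclear_norm X"
  obtains R :: "real^'n1^'n1" where
    "X = R ** transpose R ** Y" "Y ** transpose Y ** R = R" "nuclear_norm X = (norm R)\<^sup>2"
proof -
  have Y: "contraction Y" "Y \<bullet> X = nuclear_norm X"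
    using assms by (simp_all add: subdifferential_nuclear_norm_iff)
  obtain R :: "real^'n1^'n1" and Z where R: "contraction Z" "X = R ** transpose R ** Z"
    "Z ** transpose Z ** R = R" "nuclear_norm X = (norm R)\<^sup>2"
    by (rule polar_decomposition)
  have RY: "norm (transpose R ** Y) \<le> norm R"
    using norm_mult_contraction_le[OF Y(1), of "transpose R"] by simp
  have RZ: "norm (transpose R ** Z) \<le> norm R"
    using norm_mult_contraction_le[OF R(1), of "transpose R"] by simp
  have "(norm R)\<^sup>2 = Y \<bullet> (R ** transpose R ** Z)"
    using Y(2) by (simp add: R(4)[symmetric] R(2)[symmetric])
  then have "(norm R)\<^sup>2 \<le> (transpose R ** Y) \<bullet> (transpose R ** Z)"
    by (simp only: inner_gram order_refl)
  note eq = eq_if_inner_ge_power2[OF RY RZ this]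
  have "X = R ** transpose R ** Y"
    using eq(1) R(2) by (simp only: matrix_mul_assoc[symmetric])
  moreover have "Y ** transpose Y ** R = R"
  proof (rule eq_if_inner_ge_power2(1))
    have T: "norm (transpose Y ** R) = norm R"
      using eq(2) by (metis matrix_transpose_mul norm_matrix_transpose transpose_transpose)
    show "norm (Y ** transpose Y ** R) \<le> norm R"
      using norm_contraction_mult_le[OF Y(1), of "transpose Y ** R"] T by (simp add: matrix_mul_assoc)
    show "(norm R)\<^sup>2 \<le> (Y ** transpose Y ** R) \<bullet> R"
      using T by (simp add: matrix_mul_assoc[symmetric] inner_matrix_mult_left power2_norm_eq_inner[symmetric])
  qed simp
  ultimately show ?thesis using that R(4) by blast
qed

section \<open>Quantitative monotonicity of the subdifferential\<close>

text \<open>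
  These three equations are linear in \<open>X\<close>, so for a fixed \<open>Y\<close> they also hold for all differences of
  matrices that have \<open>Y\<close> as a subgradient.
\<close>

lemma subgradient_products_symmetric:
  fixes X Y :: "real^'n2^'n1"
  assumes "Y \<in> subdifferential nuclear_norm X"
  shows "X ** transpose Y = Y ** transpose X" "transpose Y ** X = transpose X ** Y"
    "Y ** transpose Y ** X = X"
proof -
  obtain R :: "real^'n1^'n1" where R: "X = R ** transpose R ** Y" "Y ** transpose Y ** R = R"
    using subgradient_factorization[OF assms] by blast
  have YYR: "Y ** (transpose Y ** R) = R"
    using R(2) by (simp only: matrix_mul_assoc)
  have X: "X = R ** transpose (transpose Y ** R)"
    by (simp add: R(1) matrix_transpose_mul matrix_mul_assoc)
  have "Y ** transpose X = R ** transpose R"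
    by (simp add: X matrix_transpose_mul matrix_mul_assoc R(2))
  then show "X ** transpose Y = Y ** transpose X"
    by (metis matrix_transpose_mul transpose_transpose)
  have "transpose Y ** X = (transpose Y ** R) ** transpose (transpose Y ** R)"
    by (simp only: X matrix_mul_assoc)
  then show "transpose Y ** X = transpose X ** Y"
    by (metis matrix_transpose_mul transpose_transpose)
  show "Y ** transpose Y ** X = X"
    by (simp only: R(1) matrix_mul_assoc R(2))
qed

text \<open>
  With \<open>X\<^sub>2 = R R\<^sup>T Y\<^sub>2\<close> and \<open>T = Y\<^sub>2\<^sup>T R\<close>, the inner products of \<open>R\<^sup>T Y\<^sub>1\<close> with \<open>R\<^sup>T Y\<^sub>2\<close> and of
  \<open>Y\<^sub>1 T\<close> with \<open>Y\<^sub>2 T\<close> both equal \<open>\<langle>Y\<^sub>1, X\<^sub>2\<rangle>\<close>, whereas all these matrices have norm at most \<open>\<parallel>R\<parallel>\<close>.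
  Expanding the squares, \<open>R\<^sup>T (Y\<^sub>1 - Y\<^sub>2)\<close> and \<open>(Y\<^sub>1 - Y\<^sub>2) T\<close> have squared norms at most
  \<open>2 (G X\<^sub>2 - \<langle>Y\<^sub>1, X\<^sub>2\<rangle>) \<le> 2 m\<close>. Each matrix in the conclusion contains one of these two factors; the bound
  \<open>C\<close> controls the other factor.
\<close>

lemma subgradient_difference_bounds:
  fixes X1 X2 Y1 Y2 :: "real^'n2^'n1"
  assumes Y1: "Y1 \<in> subdifferential nuclear_norm X1" and Y2: "Y2 \<in> subdifferential nuclear_norm X2"
    and C: "nuclear_norm X2 \<le> C\<^sup>2" "0 \<le> C"
  defines "m \<equiv> (Y1 - Y2) \<bullet> (X1 - X2)"
  shows "0 \<le> m" "norm (X2 ** transpose (Y1 - Y2)) \<le> C * sqrt (2 * m)"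
    "norm (transpose (Y1 - Y2) ** X2) \<le> C * sqrt (2 * m)"
    "norm ((Y1 - Y2) ** (transpose Y2 ** X2)) \<le> C * sqrt (2 * m)"
proof -
  let ?E = "Y1 - Y2"
  have c: "contraction Y1" "contraction Y2" and Y1X: "Y1 \<bullet> X1 = nuclear_norm X1"
    and Y2X: "Y2 \<bullet> X2 = nuclear_norm X2"
    using Y1 Y2 by (simp_all add: subdifferential_nuclear_norm_iff)
  obtain R :: "real^'n1^'n1" where R: "X2 = R ** transpose R ** Y2" "Y2 ** transpose Y2 ** R = R"
    "nuclear_norm X2 = (norm R)\<^sup>2"
    using subgradient_factorization[OF Y2] by blast
  define T where "T = transpose Y2 ** R"
  have X2: "X2 = R ** transpose T"
    by (simp add: R(1) T_def matrix_transpose_mul matrix_mul_assoc)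
  have T: "norm T \<le> norm R"
    unfolding T_def by (intro norm_contraction_mult_le contraction_transpose c)
  have Y2T: "Y2 ** T = R"
    using R(2) by (simp only: T_def matrix_mul_assoc)
  have RC: "norm R \<le> C"
    using C R(3) power2_le_imp_le by metis
  have gap: "2 * (norm R)\<^sup>2 - 2 * (Y1 \<bullet> X2) \<le> 2 * m"
    using inner_contraction_le_nuclear_norm[OF c(2), of X1] Y1X Y2X R(3)
    by (simp add: m_def inner_diff_left inner_diff_right)
  have "norm (transpose R ** ?E) \<le> sqrt (2 * m)"
  proof (rule real_le_rsqrt)
    have "(norm (transpose R ** ?E))\<^sup>2 =
        (norm (transpose R ** Y1))\<^sup>2 - 2 * (Y1 \<bullet> X2) + (norm (transpose R ** Y2))\<^sup>2"
      by (simp add: R(1) inner_gram matrix_mult_diff_right power2_norm_eq_inner inner_diff_left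
          inner_diff_right inner_commute)
    also have "\<dots> \<le> (norm R)\<^sup>2 - 2 * (Y1 \<bullet> X2) + (norm R)\<^sup>2"
      using norm_mult_contraction_le[OF c(1), of "transpose R"] norm_mult_contraction_le[OF c(2), of "transpose R"]
      by (intro add_mono diff_mono power_mono) auto
    finally show "(norm (transpose R ** ?E))\<^sup>2 \<le> 2 * m" using gap by simp
  qed
  then have ER: "norm (transpose ?E ** R) \<le> sqrt (2 * m)"
    by (metis matrix_transpose_mul norm_matrix_transpose transpose_transpose)
  have ET: "norm (?E ** T) \<le> sqrt (2 * m)"
  proof (rule real_le_rsqrt)
    have "(Y1 ** T) \<bullet> R = Y1 \<bullet> X2"
      by (simp add: X2 inner_matrix_mult_right)
    then have "(norm (?E ** T))\<^sup>2 = (norm (Y1 ** T))\<^sup>2 - 2 * (Y1 \<bullet> X2) + (norm R)\<^sup>2"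
      by (simp add: matrix_mult_diff_left Y2T power2_norm_eq_inner inner_diff_left
          inner_diff_right inner_commute)
    also have "\<dots> \<le> (norm R)\<^sup>2 - 2 * (Y1 \<bullet> X2) + (norm R)\<^sup>2"
      using norm_contraction_mult_le[OF c(1), of T] T
      by (intro add_mono diff_mono power_mono) auto
    finally show "(norm (?E ** T))\<^sup>2 \<le> 2 * m" using gap by simp
  qed
  have "0 \<le> sqrt (2 * m)"
    using ET norm_ge_zero order_trans by blast
  then show m: "0 \<le> m" by simp
  have bound: "norm (A ** B) \<le> C * sqrt (2 * m)" if "norm A \<le> C" "norm B \<le> sqrt (2 * m)"
    for A :: "real^'i^'j" and B :: "real^'k^'i"
    using norm_matrix_mult_le[of A B] mult_mono[OF that] C(2) norm_ge_zero[of B] by linarith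
  have bound': "norm (B ** A) \<le> C * sqrt (2 * m)" if "norm A \<le> C" "norm B \<le> sqrt (2 * m)"
    for A :: "real^'k^'i" and B :: "real^'i^'j"
    using norm_matrix_mult_le[of B A] mult_mono[OF that] C(2) norm_ge_zero[of B]
    by (simp add: mult.commute)
  have TC: "norm T \<le> C" using T RC by simp
  have "X2 ** transpose ?E = R ** transpose (?E ** T)"
    by (simp add: X2 matrix_transpose_mul matrix_mul_assoc)
  then show "norm (X2 ** transpose ?E) \<le> C * sqrt (2 * m)"
    using bound[OF RC, of "transpose (?E ** T)"] ET by simp
  have "transpose ?E ** X2 = (transpose ?E ** R) ** transpose T"
    by (simp add: X2 matrix_mul_assoc)
  then show "norm (transpose ?E ** X2) \<le> C * sqrt (2 * m)"
    using bound'[of "transpose T", OF _ ER] TC by simp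
  have "?E ** (transpose Y2 ** X2) = (?E ** T) ** transpose T"
    by (simp add: X2 T_def matrix_mul_assoc)
  then show "norm (?E ** (transpose Y2 ** X2)) \<le> C * sqrt (2 * m)"
    using bound'[of "transpose T", OF _ ET] TC by simp
qed

text \<open>
  Subtracting the equations for \<open>(X\<^sub>1, Y\<^sub>1)\<close> and \<open>(X\<^sub>2, Y\<^sub>2)\<close> leaves the equations for \<open>X\<^sub>1 - X\<^sub>2\<close> at \<open>Y\<^sub>1\<close>
  up to terms in which \<open>Y\<^sub>1 - Y\<^sub>2\<close> multiplies \<open>X\<^sub>2\<close>. Such terms are small by the previous lemma even if
  \<open>Y\<^sub>1 - Y\<^sub>2\<close> itself is not.
\<close>

lemma subgradient_difference_near_span:
  fixes X1 X2 Y1 Y2 :: "real^'n2^'n1"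
  assumes Y1: "Y1 \<in> subdifferential nuclear_norm X1" and Y2: "Y2 \<in> subdifferential nuclear_norm X2"
    and C: "nuclear_norm X2 \<le> C\<^sup>2" "0 \<le> C"
  defines "D \<equiv> X1 - X2" and "m \<equiv> (Y1 - Y2) \<bullet> (X1 - X2)"
  shows "norm (D ** transpose Y1 - Y1 ** transpose D) \<le> 2 * C * sqrt (2 * m)"
    "norm (transpose Y1 ** D - transpose D ** Y1) \<le> 2 * C * sqrt (2 * m)"
    "norm (D - Y1 ** transpose Y1 ** D) \<le> 2 * C * sqrt (2 * m)"
proof -
  let ?E = "Y1 - Y2"
  note b = subgradient_difference_bounds[OF Y1 Y2 C, folded m_def]
  note s1 = subgradient_products_symmetric[OF Y1] and s2 = subgradient_products_symmetric[OF Y2]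
  have "D ** transpose Y1 - Y1 ** transpose D = transpose (X2 ** transpose ?E) - X2 ** transpose ?E"
    using s1(1) s2(1)
    by (simp add: D_def transpose_diff matrix_mult_diff_left matrix_mult_diff_right matrix_transpose_mul algebra_simps)
  then show "norm (D ** transpose Y1 - Y1 ** transpose D) \<le> 2 * C * sqrt (2 * m)"
    using norm_triangle_ineq4[of "transpose (X2 ** transpose ?E)" "X2 ** transpose ?E"] b(2)
    by simp
  have "transpose Y1 ** D - transpose D ** Y1 = transpose (transpose ?E ** X2) - transpose ?E ** X2"
    using s1(2) s2(2)
    by (simp add: D_def transpose_diff matrix_mult_diff_left matrix_mult_diff_right matrix_transpose_mul algebra_simps)
  then show "norm (transpose Y1 ** D - transpose D ** Y1) \<le> 2 * C * sqrt (2 * m)"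
    using norm_triangle_ineq4[of "transpose (transpose ?E ** X2)" "transpose ?E ** X2"] b(3)
    by simp
  have "D - Y1 ** transpose Y1 ** D = Y1 ** (transpose ?E ** X2) + ?E ** (transpose Y2 ** X2)"
    using s1(3) s2(3)
    by (simp add: D_def transpose_diff matrix_mult_diff_left matrix_mult_diff_right matrix_mul_assoc algebra_simps)
  moreover have "norm (Y1 ** (transpose ?E ** X2)) \<le> C * sqrt (2 * m)"
    using b(3) norm_contraction_mult_le[of Y1 "transpose ?E ** X2"] Y1
    by (simp add: subdifferential_nuclear_norm_iff)
  ultimately show "norm (D - Y1 ** transpose Y1 ** D) \<le> 2 * C * sqrt (2 * m)"
    using b(4) norm_triangle_ineq[of "Y1 ** (transpose ?E ** X2)" "?E ** (transpose Y2 ** X2)"] by simp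
qed

text \<open>
  For a contraction \<open>Y\<close>, this is the linear span of the normal cone \<open>{X. Y \<in> \<partial>G X}\<close> of the unit ball of the
  spectral norm at \<open>Y\<close>: the cone consists of the products \<open>H Y\<close>, and the span of the products \<open>B Y\<close>, with
  \<open>Y Y\<^sup>T H = H\<close> and \<open>Y Y\<^sup>T B = B\<close>, where \<open>H\<close> is positive semidefinite and \<open>B\<close> symmetric. The
  equations, unlike this parametrization, can be checked up to an error, and this error changes little with \<open>Y\<close>.
\<close>

definition normal_cone_span :: "real^'n2^'n1 \<Rightarrow> (real^'n2^'n1) set" where
  "normal_cone_span Y = {W. Y ** transpose Y ** W = W \<and> W ** transpose Y = Y ** transpose W \<and>
     transpose Y ** W = transpose W ** Y}"

text \<open>
  The defining equations of \<open>normal_cone_span Ybar\<close> together with \<open>\<Phi>\<close> form an injective linear map \<open>L\<close>, which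
  is bounded below by some \<open>B > 0\<close>. On \<open>D = X\<^sub>1 - X\<^sub>2\<close> its components other than \<open>\<Phi> D\<close> are of order
  \<open>\<surd>m\<close>, apart from the error of replacing \<open>Y\<^sub>1\<close> by \<open>Ybar\<close>, which is at most a multiple of
  \<open>\<eta> \<parallel>D\<parallel>\<close> and gets absorbed by the lower bound.
\<close>

lemma subgradient_monotonicity_modulus:
  fixes Ybar :: "real^'n2^'n1" and \<Phi> :: "real^'n2^'n1 \<Rightarrow> 'b::euclidean_space"
  assumes \<Phi>: "linear \<Phi>" and Ybar: "contraction Ybar"
    and inj: "\<And>W. W \<in> normal_cone_span Ybar \<Longrightarrow> \<Phi> W = 0 \<Longrightarrow> W = 0"
  obtains \<kappa> \<eta> where "0 < \<kappa>" "0 < \<eta>"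
    "\<And>X1 X2 Y1 Y2 :: real^'n2^'n1. Y1 \<in> subdifferential nuclear_norm X1 \<Longrightarrow> Y2 \<in> subdifferential nuclear_norm X2 \<Longrightarrow>
      norm (Y1 - Ybar) \<le> \<eta> \<Longrightarrow> nuclear_norm X2 \<le> C \<Longrightarrow>
      \<kappa> * (norm (X1 - X2))\<^sup>2 \<le> (norm (\<Phi> (X1 - X2)))\<^sup>2 + (Y1 - Y2) \<bullet> (X1 - X2)"
proof -
  interpret \<Phi>: linear \<Phi> by (fact \<Phi>)
  define L where "L D = (\<Phi> D, D ** transpose Ybar - Ybar ** transpose D,
    transpose Ybar ** D - transpose D ** Ybar, D - Ybar ** transpose Ybar ** D)" for D
  have "linear L"
    by (rule linearI)
      (simp_all add: L_def \<Phi>.add \<Phi>.scaleR transpose_add transpose_scalar matrix_mult_add_left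
        matrix_mult_add_right matrix_mult_scaleR_left matrix_mult_scaleR_right algebra_simps)
  moreover have "inj L"
    unfolding linear_injective_0[OF \<open>linear L\<close>]
    by (auto simp: L_def zero_prod_def normal_cone_span_def intro!: inj)
  ultimately obtain B where B: "0 < B" "\<And>D. B * norm D \<le> norm (L D)"
    using linear_inj_bounded_below_pos by blast
  define K where "K = sqrt (max C 0)"
  have K: "0 \<le> K" "C \<le> K\<^sup>2" by (auto simp: K_def)
  \<comment> \<open>The three replacements of \<open>Y\<^sub>1\<close> by \<open>Ybar\<close> cost \<open>6 \<eta> \<parallel>D\<parallel> = B / 2 * \<parallel>D\<parallel>\<close>. The value of
    \<open>\<kappa>\<close> results from squaring the remaining estimate
    \<open>B / 2 * \<parallel>D\<parallel> \<le> \<parallel>\<Phi> D\<parallel> + 6 K \<surd>(2 m)\<close>.\<close>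
  define \<eta> where "\<eta> = B / 12"
  define \<kappa> where "\<kappa> = B\<^sup>2 / (8 + 576 * K\<^sup>2)"
  have pos: "0 < 8 + 576 * K\<^sup>2" by (simp add: add_pos_nonneg)
  show ?thesis
  proof (rule that[of \<kappa> \<eta>])
    show "0 < \<kappa>" "0 < \<eta>" using B(1) pos by (auto simp: \<kappa>_def \<eta>_def)
    fix X1 X2 Y1 Y2 :: "real^'n2^'n1"
    assume Y1: "Y1 \<in> subdifferential nuclear_norm X1" and Y2: "Y2 \<in> subdifferential nuclear_norm X2"
      and near: "norm (Y1 - Ybar) \<le> \<eta>" and "nuclear_norm X2 \<le> C"
    then have C: "nuclear_norm X2 \<le> K\<^sup>2" using K by simp
    define D where "D = X1 - X2"
    define m where "m = (Y1 - Y2) \<bullet> (X1 - X2)"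
    note t = subgradient_difference_near_span[OF Y1 Y2 C K(1), folded m_def, folded D_def]
    have m: "0 \<le> m"
      using subgradient_difference_bounds(1)[OF Y1 Y2 C K(1)] by (simp add: m_def)
    have c1: "contraction Y1" using Y1 by (simp add: subdifferential_nuclear_norm_iff)
    let ?F = "Ybar - Y1"
    have F: "norm ?F \<le> \<eta>" using near by (simp add: norm_minus_commute)
    have FD: "norm (A ** A') \<le> \<eta> * norm D" if "norm A \<le> norm D" "norm A' \<le> \<eta>"
      for A :: "real^'i^'j" and A' :: "real^'k^'i"
      using norm_matrix_mult_le[of A A'] mult_mono[OF that] by (simp add: mult.commute)
    have FD': "norm (A' ** A) \<le> \<eta> * norm D" if "norm A \<le> norm D" "norm A' \<le> \<eta>"
      for A :: "real^'k^'i" and A' :: "real^'i^'j"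
      using norm_matrix_mult_le[of A' A] mult_mono[OF that(2,1)] \<open>0 < \<eta>\<close> by simp
    have tri: "norm (a + b - c) \<le> p + 2 * \<eta> * norm D" "norm (a - b - c) \<le> p + 2 * \<eta> * norm D"
      if "norm a \<le> p" "norm b \<le> \<eta> * norm D" "norm c \<le> \<eta> * norm D" for a b c :: "real^'i^'j" and p
      using that norm_triangle_ineq4[of "a + b" c] norm_triangle_ineq[of a b]
        norm_triangle_ineq4[of "a - b" c] norm_triangle_ineq4[of a b] by linarith+
    have 1: "norm (D ** transpose Ybar - Ybar ** transpose D) \<le> 2 * K * sqrt (2 * m) + 2 * \<eta> * norm D"
    proof -
      have "D ** transpose Ybar - Ybar ** transpose D =
          (D ** transpose Y1 - Y1 ** transpose D) + D ** transpose ?F - ?F ** transpose D"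
        by (simp add: transpose_diff matrix_mult_diff_left matrix_mult_diff_right)
      moreover have "norm (D ** transpose ?F) \<le> \<eta> * norm D" "norm (?F ** transpose D) \<le> \<eta> * norm D"
        using FD[of D "transpose ?F"] FD'[of "transpose D" ?F] F by simp_all
      ultimately show ?thesis
        using tri(1)[OF t(1)] by metis
    qed
    have 2: "norm (transpose Ybar ** D - transpose D ** Ybar) \<le> 2 * K * sqrt (2 * m) + 2 * \<eta> * norm D"
    proof -
      have "transpose Ybar ** D - transpose D ** Ybar =
          (transpose Y1 ** D - transpose D ** Y1) + transpose ?F ** D - transpose D ** ?F"
        by (simp add: transpose_diff matrix_mult_diff_left matrix_mult_diff_right)
      moreover have "norm (transpose D ** ?F) \<le> \<eta> * norm D" "norm (transpose ?F ** D) \<le> \<eta> * norm D"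
        using FD[of "transpose D" ?F] FD'[of D "transpose ?F"] F by simp_all
      ultimately show ?thesis
        using tri(1)[OF t(2)] by metis
    qed
    have 3: "norm (D - Ybar ** transpose Ybar ** D) \<le> 2 * K * sqrt (2 * m) + 2 * \<eta> * norm D"
    proof -
      have "D - Ybar ** transpose Ybar ** D =
          (D - Y1 ** transpose Y1 ** D) - Y1 ** (transpose ?F ** D) - ?F ** (transpose Ybar ** D)"
        by (simp add: transpose_diff matrix_mult_diff_left matrix_mult_diff_right matrix_mul_assoc)
      moreover have "norm (Y1 ** (transpose ?F ** D)) \<le> \<eta> * norm D"
        using norm_contraction_mult_le[OF c1, of "transpose ?F ** D"] FD'[of D "transpose ?F"] F by simp
      moreover have "norm (?F ** (transpose Ybar ** D)) \<le> \<eta> * norm D"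
        using norm_contraction_mult_le[OF contraction_transpose[OF Ybar], of D] F by (intro FD') auto
      ultimately show ?thesis
        using tri(2)[OF t(3)] by metis
    qed
    have quad: "norm (a, b, c, d) \<le> norm a + norm b + norm c + norm d"
      for a :: 'b and b :: "real^'n1^'n1" and c :: "real^'n2^'n2" and d :: "real^'n2^'n1"
      using norm_Pair_le[of a "(b, c, d)"] norm_Pair_le[of b "(c, d)"] norm_Pair_le[of c d] by linarith
    have "norm (L D) \<le> norm (\<Phi> D) + norm (D ** transpose Ybar - Ybar ** transpose D) +
        norm (transpose Ybar ** D - transpose D ** Ybar) + norm (D - Ybar ** transpose Ybar ** D)"
      unfolding L_def by (rule quad)
    with 1 2 3 B(2)[of D] have "B * norm D \<le> norm (\<Phi> D) + 6 * K * sqrt (2 * m) + 6 * \<eta> * norm D"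
      by simp
    then have half: "B / 2 * norm D \<le> norm (\<Phi> D) + 6 * K * sqrt (2 * m)"
      by (simp add: \<eta>_def)
    have "(B / 2 * norm D)\<^sup>2 \<le> (norm (\<Phi> D) + 6 * K * sqrt (2 * m))\<^sup>2"
      using half B(1) by (intro power_mono) auto
    also have "\<dots> \<le> 2 * (norm (\<Phi> D))\<^sup>2 + 2 * (6 * K * sqrt (2 * m))\<^sup>2"
      using zero_le_power2[of "norm (\<Phi> D) - 6 * K * sqrt (2 * m)"] by (simp add: power2_eq_square algebra_simps)
    also have "\<dots> = 2 * (norm (\<Phi> D))\<^sup>2 + 144 * K\<^sup>2 * m"
      using m by (simp add: power_mult_distrib)
    also have "\<dots> \<le> (2 + 144 * K\<^sup>2) * ((norm (\<Phi> D))\<^sup>2 + m)"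
      using m by (simp add: algebra_simps)
    finally have "\<kappa> * (norm D)\<^sup>2 \<le> (norm (\<Phi> D))\<^sup>2 + m"
      using pos by (simp add: \<kappa>_def power_mult_distrib divide_simps algebra_simps)
    then show "\<kappa> * (norm (X1 - X2))\<^sup>2 \<le> (norm (\<Phi> (X1 - X2)))\<^sup>2 + (Y1 - Y2) \<bullet> (X1 - X2)"
      by (simp add: D_def m_def)
  qed
qed

section \<open>Nondegenerate subgradients\<close>

lemma positive_semidefinite_gram:
  fixes H :: "real^'n^'n"
  assumes "transpose H = H" and psd: "\<And>z. 0 \<le> z \<bullet> (H *v z)"
  obtains S :: "real^'n^'n" where "H = S ** transpose S"
proof -
  obtain Q d where Q: "orthogonal_matrix Q" and H: "H = Q ** diagonal d ** transpose Q"
    using spectral_decomposition[OF assms(1)] .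
  have QQ: "transpose Q ** Q = mat 1"
    using Q by (simp add: orthogonal_matrix_def)
  have "0 \<le> d i" for i
  proof -
    have "0 \<le> (Q *v axis i 1) \<bullet> (H *v (Q *v axis i 1))" by (rule psd)
    also have "\<dots> = axis i 1 \<bullet> ((transpose Q ** Q ** diagonal d ** (transpose Q ** Q)) *v axis i 1)"
      by (simp only: inner_matrix_vector_mult H matrix_vector_mul_assoc matrix_mul_assoc)
    also have "\<dots> = d i"
      by (simp add: QQ inner_axis' diagonal_vector_mult)
    finally show ?thesis .
  qed
  then have sqrt: "sqrt (d i) * sqrt (d i) = d i" for i by simp
  have "(Q ** diagonal (\<lambda>i. sqrt (d i))) ** transpose (Q ** diagonal (\<lambda>i. sqrt (d i))) =
      Q ** (diagonal (\<lambda>i. sqrt (d i)) ** diagonal (\<lambda>i. sqrt (d i))) ** transpose Q"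
    by (simp only: matrix_transpose_mul transpose_diagonal matrix_mul_assoc)
  also have "\<dots> = H"
    by (simp only: diagonal_mult sqrt H)
  finally show ?thesis using that by metis
qed

lemma convex_subdifferential: "convex (subdifferential g x)"
proof -
  have "subdifferential g x = (\<Inter>z. {v. (z - x) \<bullet> v \<le> g z - g x})"
    by (auto simp: subdifferential_def inner_commute algebra_simps)
  then show ?thesis
    by (simp add: convex_INT convex_halfspace_le)
qed

text \<open>
  If \<open>e \<noteq> 0\<close>, let \<open>P\<close> be the orthogonal projection onto the line through \<open>e\<close>. As \<open>X\<^sup>T e = 0\<close>, the
  matrix \<open>Y - P Y\<close> is a subgradient too, so relative interiority allows one to move a little beyond \<open>Y\<close>,
  to \<open>Y + (m - 1) P Y\<close> with \<open>m > 1\<close>. But this matrix maps \<open>Y\<^sup>T e\<close> to \<open>m e\<close> and is no contraction.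
\<close>

lemma nondegenerate_subgradient_kernel:
  fixes X Y :: "real^'n2^'n1"
  assumes ri: "Y \<in> rel_interior (subdifferential nuclear_norm X)"
    and e: "Y *v (transpose Y *v e) = e" "transpose X *v e = 0"
  shows "e = 0"
proof (rule ccontr)
  assume "e \<noteq> 0"
  let ?S = "subdifferential nuclear_norm X"
  have "Y \<in> ?S" using ri rel_interior_subset by blast
  then have Y: "contraction Y" "Y \<bullet> X = nuclear_norm X"
    by (simp_all add: subdifferential_nuclear_norm_iff)
  define P :: "real^'n1^'n1" where "P = (\<chi> i j. e $ i * e $ j / (e \<bullet> e))"
  have P: "P *v w = ((e \<bullet> w) / (e \<bullet> e)) *\<^sub>R e" for w
    by (simp add: P_def matrix_vector_mult_def vec_eq_iff inner_vec_def[of e w] sum_divide_distrib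
        sum_distrib_left sum_distrib_right mult_ac)
  define Y' where "Y' = Y - P ** Y"
  have Y'v: "Y' *v v = Y *v v - P *v (Y *v v)" for v
    by (simp add: Y'_def matrix_vector_mult_diff_rdistrib matrix_vector_mul_assoc)
  have "norm (w - P *v w) \<le> norm w" for w
  proof (rule power2_le_imp_le)
    define k where "k = (e \<bullet> w) / (e \<bullet> e)"
    have k: "e \<bullet> w = k * (e \<bullet> e)"
      using \<open>e \<noteq> 0\<close> by (simp add: k_def)
    have "(norm (w - P *v w))\<^sup>2 = w \<bullet> w - 2 * k * (e \<bullet> w) + k * (k * (e \<bullet> e))"
      by (simp add: P k_def[symmetric] power2_norm_eq_inner inner_diff inner_commute algebra_simps)
    also have "\<dots> = (norm w)\<^sup>2 - k\<^sup>2 * (e \<bullet> e)"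
      by (simp add: k dot_square_norm power2_eq_square)
    finally show "(norm (w - P *v w))\<^sup>2 \<le> (norm w)\<^sup>2" by simp
  qed simp
  then have "contraction Y'"
    using Y(1) order_trans unfolding contraction_def Y'v by blast
  moreover have "Y' \<bullet> X = Y \<bullet> X"
  proof -
    have "X ** transpose Y = Y ** transpose X"
      using subgradient_products_symmetric(1)[OF \<open>Y \<in> ?S\<close>] .
    then have XYe: "(X ** transpose Y) *v e = 0"
      using e(2) by (simp only: matrix_vector_mul_assoc[symmetric]) simp
    have "(P ** Y) \<bullet> X = P \<bullet> (X ** transpose Y)"
      by (rule inner_matrix_mult_right)
    also have "\<dots> = (e \<bullet> ((X ** transpose Y) *v e)) / (e \<bullet> e)"
      by (simp add: P_def inner_vec_def matrix_vector_mult_def sum_distrib_left sum_divide_distrib mult_ac)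
    finally show ?thesis by (simp add: Y'_def inner_diff_left XYe)
  qed
  ultimately have "Y' \<in> ?S"
    using Y(2) by (simp add: subdifferential_nuclear_norm_iff)
  then obtain m where m: "1 < m" "(1 - m) *\<^sub>R Y' + m *\<^sub>R Y \<in> ?S"
    using convex_rel_interior_if2[OF convex_subdifferential ri] hull_inc[of Y' ?S affine] by blast
  let ?v = "transpose Y *v e"
  have "contraction ((1 - m) *\<^sub>R Y' + m *\<^sub>R Y)"
    using m(2) by (simp add: subdifferential_nuclear_norm_iff)
  then have "norm (((1 - m) *\<^sub>R Y' + m *\<^sub>R Y) *v ?v) \<le> norm ?v"
    unfolding contraction_def by blast
  also have "((1 - m) *\<^sub>R Y' + m *\<^sub>R Y) *v ?v = m *\<^sub>R e"
    using \<open>e \<noteq> 0\<close> e(1)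
    by (simp only: matrix_vector_mult_add_rdistrib scaleR_matrix_vector_assoc[symmetric] Y'v P) simp
  finally have "m * norm e \<le> norm ?v" using m(1) by simp
  also have "\<dots> \<le> norm e"
    using contraction_transpose[OF Y(1)] unfolding contraction_def by blast
  finally show False using m(1) \<open>e \<noteq> 0\<close> by simp
qed

text \<open>
  Write \<open>X = R R\<^sup>T Y\<close> and \<open>W = B Y\<close> with \<open>B = W Y\<^sup>T\<close> symmetric. Both \<open>R R\<^sup>T\<close> and \<open>B\<close>
  live on the eigenspace \<open>V = {e. Y Y\<^sup>T e = e}\<close>, and \<open>R R\<^sup>T\<close> is positive definite there by the
  previous lemma. So \<open>H = R R\<^sup>T + t B\<close> is positive semidefinite for small \<open>t\<close>, and \<open>X + t W = H Y\<close> belongs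
  to the normal cone at \<open>Y\<close>.
\<close>

lemma nondegenerate_subgradient_persists:
  fixes X Y W :: "real^'n2^'n1"
  assumes ri: "Y \<in> rel_interior (subdifferential nuclear_norm X)" and W: "W \<in> normal_cone_span Y"
  shows "\<exists>t>0. Y \<in> subdifferential nuclear_norm (X + t *\<^sub>R W)"
proof -
  have sub: "Y \<in> subdifferential nuclear_norm X"
    using ri rel_interior_subset by blast
  then have Y: "contraction Y"
    by (simp add: subdifferential_nuclear_norm_iff)
  obtain R :: "real^'n1^'n1" where R: "X = R ** transpose R ** Y" "Y ** transpose Y ** R = R"
    using subgradient_factorization[OF sub] by blast
  define B where "B = W ** transpose Y"
  have B: "transpose B = B" "Y ** transpose Y ** B = B" "B ** Y = W"
  proof -
    have W': "Y ** transpose Y ** W = W" "W ** transpose Y = Y ** transpose W"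
      "transpose Y ** W = transpose W ** Y"
      using W by (simp_all add: normal_cone_span_def)
    show "transpose B = B"
      using W'(2) by (simp add: B_def matrix_transpose_mul)
    show "Y ** transpose Y ** B = B"
      by (simp only: B_def matrix_mul_assoc W'(1))
    have "B ** Y = Y ** (transpose W ** Y)"
      by (simp only: B_def W'(2) matrix_mul_assoc)
    also have "\<dots> = W"
      using W'(1) by (simp only: W'(3)[symmetric] matrix_mul_assoc)
    finally show "B ** Y = W" .
  qed
  define V where "V = {e. (Y ** transpose Y) *v e = e}"
  have V: "subspace V"
    by (auto simp: V_def subspace_def matrix_vector_right_distrib matrix_vector_mult_scaleR)
  have RV: "R *v x \<in> V" and BV: "B *v x \<in> V" for x
    by (simp_all add: V_def matrix_vector_mul_assoc R(2) B(2))
  have R_inj: "transpose R *v e \<noteq> 0" if "e \<in> V" "e \<noteq> 0" for e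
  proof
    assume "transpose R *v e = 0"
    then have "transpose X *v e = 0"
      by (simp add: R(1) matrix_transpose_mul matrix_vector_mul_assoc[symmetric] del: transpose_matrix_vector)
    moreover have "Y *v (transpose Y *v e) = e"
      using that(1) by (simp only: V_def mem_Collect_eq matrix_vector_mul_assoc)
    ultimately show False
      using nondegenerate_subgradient_kernel[OF ri] that(2) by blast
  qed
  obtain c where c: "0 < c" "\<And>e. e \<in> V \<Longrightarrow> c * norm e \<le> norm (transpose R *v e)"
    using injective_imp_isometric[OF closed_subspace[OF V] V] R_inj
    by (metis matrix_vector_mul_bounded_linear)
  define t where "t = c\<^sup>2 / (norm B + 1)"
  have t: "0 < t" using c(1) by (auto simp: t_def intro!: divide_pos_pos add_nonneg_pos)
  define H where "H = R ** transpose R + t *\<^sub>R B"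
  have Hv: "H *v z = R *v (transpose R *v z) + t *\<^sub>R (B *v z)" for z
    by (simp only: H_def matrix_vector_mult_add_rdistrib scaleR_matrix_vector_assoc matrix_vector_mul_assoc)
  have H_sym: "transpose H = H"
    by (simp add: H_def transpose_add transpose_scalar matrix_transpose_mul B(1))
  have "0 \<le> z \<bullet> (H *v z)" for z
  proof -
    \<comment> \<open>As \<open>H\<close> vanishes on the orthogonal complement of \<open>V\<close>, only the component of \<open>z\<close> in \<open>V\<close> counts.\<close>
    obtain e e' where z: "e \<in> span V" "\<And>w. w \<in> span V \<Longrightarrow> orthogonal e' w" "z = e + e'"
      using orthogonal_subspace_decomp_exists[of V z] by metis
    then have e: "e \<in> V" and orth: "\<And>w. w \<in> V \<Longrightarrow> e' \<bullet> w = 0"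
      using V by (auto simp: span_eq_iff[THEN iffD2] orthogonal_def span_base)
    have "(transpose R *v e') \<bullet> (transpose R *v e') = 0"
      using orth[OF RV] by (simp only: inner_matrix_vector_mult transpose_transpose)
    then have "transpose R *v e' = 0" by (simp only: inner_eq_zero_iff)
    moreover have "(B *v e') \<bullet> (B *v e') = 0"
      using orth[OF BV] by (simp only: inner_matrix_vector_mult B(1))
    then have "B *v e' = 0" by (simp only: inner_eq_zero_iff)
    ultimately have "H *v e' = 0" by (simp only: Hv matrix_vector_mult_0_right scaleR_zero_right add_0)
    then have "z \<bullet> (H *v z) = e \<bullet> (H *v e)"
      using inner_matrix_vector_mult[of H e' e]
      by (simp add: z(3) matrix_vector_right_distrib inner_add_left H_sym)
    also have "\<dots> = (norm (transpose R *v e))\<^sup>2 + t * (e \<bullet> (B *v e))"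
      by (simp only: Hv inner_add_right inner_scaleR_right power2_norm_eq_inner inner_matrix_vector_mult transpose_transpose)
    also have "\<dots> \<ge> (c * norm e)\<^sup>2 - t * (norm B * (norm e)\<^sup>2)"
    proof -
      have "(c * norm e)\<^sup>2 \<le> (norm (transpose R *v e))\<^sup>2"
        using c(1) c(2)[OF e] by (intro power_mono) auto
      moreover have "- (norm B * (norm e)\<^sup>2) \<le> e \<bullet> (B *v e)"
        using Cauchy_Schwarz_ineq2[of e "B *v e"]
          mult_left_mono[OF norm_matrix_vector_mult_le[of B e] norm_ge_zero[of e]]
        by (simp add: power2_eq_square abs_le_iff mult_ac)
      then have "- (t * (norm B * (norm e)\<^sup>2)) \<le> t * (e \<bullet> (B *v e))"
        using t mult_left_mono[of "- (norm B * (norm e)\<^sup>2)" "e \<bullet> (B *v e)" t] by simp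
      ultimately show ?thesis by simp
    qed
    moreover have "t * norm B \<le> c\<^sup>2"
      using norm_ge_zero[of B] by (simp add: t_def divide_simps add_nonneg_pos mult_left_mono)
    then have "t * (norm B * (norm e)\<^sup>2) \<le> (c * norm e)\<^sup>2"
      using mult_right_mono[of "t * norm B" "c\<^sup>2" "(norm e)\<^sup>2"] by (simp add: power_mult_distrib mult.assoc)
    ultimately show ?thesis by simp
  qed
  then obtain S :: "real^'n1^'n1" where S: "H = S ** transpose S"
    using positive_semidefinite_gram[OF H_sym] by blast
  have X_t: "X + t *\<^sub>R W = S ** transpose S ** Y"
    by (simp only: S[symmetric] H_def matrix_mult_add_left matrix_mult_scaleR_left B(3) R(1)[symmetric])
  have YYH: "Y ** transpose Y ** H = H"
    by (simp only: H_def matrix_mult_add_right matrix_mult_scaleR_right B(2) matrix_mul_assoc R(2))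
  have "(X + t *\<^sub>R W) \<bullet> Y = H \<bullet> (Y ** transpose Y)"
    by (simp only: X_t S[symmetric] inner_matrix_mult_right)
  also have "\<dots> = mat 1 \<bullet> (Y ** transpose Y ** H)"
    using inner_matrix_mult_right[of "mat 1" H "Y ** transpose Y"] H_sym by simp
  also have "\<dots> = (S ** transpose S) \<bullet> mat 1"
    by (metis YYH S inner_commute)
  also have "\<dots> = (norm S)\<^sup>2"
    by (simp add: inner_matrix_mult_right power2_norm_eq_inner)
  finally have "nuclear_norm (X + t *\<^sub>R W) \<le> Y \<bullet> (X + t *\<^sub>R W)"
    using nuclear_norm_gram_le[OF Y, of S] by (simp add: X_t inner_commute)
  then have "Y \<in> subdifferential nuclear_norm (X + t *\<^sub>R W)"
    using Y inner_contraction_le_nuclear_norm[OF Y] by (simp add: subdifferential_nuclear_norm_iff order_antisym)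
  with t show ?thesis by blast
qed

section \<open>Smooth functions with positive definite Hessian\<close>

lemma GDERIV_gradient:
  fixes g :: "'a::euclidean_space \<Rightarrow> real"
  assumes "g differentiable (at y)"
  shows "GDERIV g y :> gradient g y"
proof -
  obtain g' where g': "(g has_derivative g') (at y)"
    using assms by (auto simp: differentiable_def)
  have "g' = (\<lambda>v. v \<bullet> adjoint g' 1)"
    using adjoint_works[OF has_derivative_linear[OF g']] by fastforce
  then have D: "GDERIV g y :> adjoint g' 1"
    using g' by (simp add: gderiv_def)
  moreover have "E = adjoint g' 1" if "GDERIV g y :> E" for E
  proof -
    have "(\<lambda>v. v \<bullet> E) = (\<lambda>v. v \<bullet> adjoint g' 1)"
      using that D has_derivative_unique unfolding gderiv_def by blast
    then show ?thesis by (metis vector_eq_ldot)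
  qed
  ultimately show ?thesis
    unfolding gradient_def by (rule theI)
qed

lemma gradient_has_derivative_hessian:
  assumes "gradient g differentiable (at y)"
  shows "(gradient g has_derivative (*v) (hessian g y)) (at y)"
proof -
  have D: "(gradient g has_derivative frechet_derivative (gradient g) (at y)) (at y)"
    using assms frechet_derivative_works by blast
  then show ?thesis
    using has_derivative_linear[OF D] by (simp add: hessian_def linear_matrix_vector_mul_eq)
qed

lemma positive_definite_coercive:
  fixes H :: "real^'n^'n"
  assumes "positive_definite H"
  obtains q where "0 < q" "\<And>v. q * (norm v)\<^sup>2 \<le> v \<bullet> (H *v v)"
proof -
  have "sphere 0 1 \<noteq> ({} :: (real^'n) set)"
    by simp
  then obtain w :: "real^'n" where w: "norm w = 1"
    and min: "\<And>v. norm v = 1 \<Longrightarrow> w \<bullet> (H *v w) \<le> v \<bullet> (H *v v)"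
    using continuous_attains_inf[of "sphere 0 1" "\<lambda>v :: real^'n. v \<bullet> (H *v v)"]
      linear_continuous_on[OF matrix_vector_mul_bounded_linear[of H]]
    by (force intro: continuous_intros)
  have "w \<bullet> (H *v w) * (norm v)\<^sup>2 \<le> v \<bullet> (H *v v)" for v
  proof (cases "v = 0")
    case False
    then have "w \<bullet> (H *v w) \<le> (v /\<^sub>R norm v) \<bullet> (H *v (v /\<^sub>R norm v))"
      by (intro min) simp
    also have "\<dots> = (v \<bullet> (H *v v)) / (norm v)\<^sup>2"
      by (simp add: matrix_vector_mult_scaleR power2_eq_square divide_inverse mult_ac)
    finally show ?thesis using False by (simp add: field_simps)
  qed simp
  moreover have "0 < w \<bullet> (H *v w)"
  proof -
    have "w \<noteq> 0" using w by auto
    then show ?thesis using assms unfolding positive_definite_def by blast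
  qed
  ultimately show ?thesis using that by blast
qed

text \<open>
  By continuity the Hessian stays above half of its coercivity constant at \<open>y\<close> on a ball around \<open>y\<close>; the mean
  value theorem along the segment from \<open>v\<close> to \<open>u\<close> integrates this bound.
\<close>

lemma gradient_strongly_monotone_near:
  fixes g :: "real^'m \<Rightarrow> real"
  assumes "open U" and g: "twice_continuously_differentiable_on g U" and "y \<in> U"
    and "positive_definite (hessian g y)"
  obtains \<mu> \<rho> where "0 < \<mu>" "0 < \<rho>" "ball y \<rho> \<subseteq> U"
    "\<And>u v. u \<in> ball y \<rho> \<Longrightarrow> v \<in> ball y \<rho> \<Longrightarrow> \<mu> * (norm (u - v))\<^sup>2 \<le> (gradient g u - gradient g v) \<bullet> (u - v)"
proof -
  obtain q where q: "0 < q" "\<And>v. q * (norm v)\<^sup>2 \<le> v \<bullet> (hessian g y *v v)"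
    using positive_definite_coercive[OF assms(4)] by blast
  have "isCont (hessian g) y"
    using g \<open>open U\<close> \<open>y \<in> U\<close>
    by (simp add: twice_continuously_differentiable_on_def continuous_on_eq_continuous_at)
  then have "\<forall>\<^sub>F z in nhds y. dist (hessian g z) (hessian g y) < q / 2"
    using q(1) tendstoD[of "hessian g" "hessian g y" "at y" "q / 2"]
    by (simp add: isCont_def eventually_nhds_conv_at)
  then have "\<forall>\<^sub>F z in nhds y. z \<in> U \<and> dist (hessian g z) (hessian g y) < q / 2"
    using eventually_nhds_in_open[OF \<open>open U\<close> \<open>y \<in> U\<close>] eventually_conj by blast
  then obtain \<rho> where \<rho>: "0 < \<rho>" "\<And>z. z \<in> ball y \<rho> \<Longrightarrow> z \<in> U \<and> dist (hessian g z) (hessian g y) < q / 2"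
    by (auto simp: eventually_nhds_metric dist_commute)
  have H: "q / 2 * (norm v)\<^sup>2 \<le> v \<bullet> (hessian g z *v v)" if z: "z \<in> ball y \<rho>" for z v
  proof -
    let ?E = "hessian g z - hessian g y"
    have "\<bar>v \<bullet> (?E *v v)\<bar> \<le> norm v * (norm ?E * norm v)"
      using Cauchy_Schwarz_ineq2[of v "?E *v v"]
        mult_left_mono[OF norm_matrix_vector_mult_le[of ?E v] norm_ge_zero[of v]] by linarith
    also have "\<dots> \<le> norm v * (q / 2 * norm v)"
      using \<rho>(2)[OF z] by (intro mult_left_mono mult_right_mono) (auto simp: dist_norm)
    finally have "\<bar>v \<bullet> (?E *v v)\<bar> \<le> q / 2 * (norm v)\<^sup>2"
      by (simp add: power2_eq_square mult_ac)
    moreover have "v \<bullet> (hessian g z *v v) = v \<bullet> (hessian g y *v v) + v \<bullet> (?E *v v)"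
      by (simp add: matrix_vector_mult_diff_rdistrib inner_diff_right)
    ultimately show ?thesis
      using q(2)[of v] by linarith
  qed
  show ?thesis
  proof (rule that[of "q / 2" \<rho>])
    fix u v assume uv: "u \<in> ball y \<rho>" "v \<in> ball y \<rho>"
    define w where "w = u - v"
    have seg: "v + t *\<^sub>R w \<in> ball y \<rho>" if "0 \<le> t" "t \<le> 1" for t
    proof -
      have "v + t *\<^sub>R w = (1 - t) *\<^sub>R v + t *\<^sub>R u"
        by (simp add: w_def algebra_simps)
      then show ?thesis
        using convexD[OF convex_ball uv(2,1), of "1 - t" t] that by simp
    qed
    have deriv: "((\<lambda>t. gradient g (v + t *\<^sub>R w) \<bullet> w) has_real_derivative
        w \<bullet> (hessian g (v + t *\<^sub>R w) *v w)) (at t)" if "0 \<le> t" "t \<le> 1" for t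
    proof -
      have "gradient g differentiable (at (v + t *\<^sub>R w))"
        using g \<rho>(2)[OF seg[OF that]] by (simp add: twice_continuously_differentiable_on_def)
      note D = gradient_has_derivative_hessian[OF this]
      have "((\<lambda>t. v + t *\<^sub>R w) has_derivative (\<lambda>s. s *\<^sub>R w)) (at t)"
        by (auto intro!: derivative_eq_intros)
      from has_derivative_inner_left[OF has_derivative_compose[OF this D], of w] show ?thesis
        by (rule has_derivative_imp_has_field_derivative)
          (simp add: matrix_vector_mult_scaleR inner_commute)
    qed
    obtain t where t: "0 < t" "t < 1" "gradient g (v + 1 *\<^sub>R w) \<bullet> w - gradient g (v + 0 *\<^sub>R w) \<bullet> w =
        (1 - 0) * (w \<bullet> (hessian g (v + t *\<^sub>R w) *v w))"
      using MVT2[of 0 1 "\<lambda>t. gradient g (v + t *\<^sub>R w) \<bullet> w" "\<lambda>t. w \<bullet> (hessian g (v + t *\<^sub>R w) *v w)", OF _ deriv]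
      by auto
    then have "(gradient g u - gradient g v) \<bullet> w = w \<bullet> (hessian g (v + t *\<^sub>R w) *v w)"
      by (simp add: w_def inner_diff_left)
    then show "q / 2 * (norm (u - v))\<^sup>2 \<le> (gradient g u - gradient g v) \<bullet> (u - v)"
      using H[OF seg, of t w] t(1,2) by (simp add: w_def)
  qed (use q(1) \<rho> in auto)
qed

section \<open>Minimizers of tilted convex functions\<close>

lemma mem_argmin_iff: "x \<in> argmin g \<longleftrightarrow> (\<forall>y. g x \<le> g y)"
  by (auto simp: argmin_def is_arg_min_def not_less)

text \<open>
  Fermat's rule: convexity of \<open>G\<close> bounds its difference quotients along the segment from \<open>X\<close> to \<open>Z\<close> by
  \<open>G Z - G X\<close>, while those of \<open>h\<close> converge to the slope given by \<open>d\<close>, so minimality along the segment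
  becomes the subgradient inequality in the limit.
\<close>

lemma composite_minimizer_subgradient:
  fixes \<Phi> :: "'a::euclidean_space \<Rightarrow> 'b::euclidean_space"
  assumes \<Phi>: "linear \<Phi>" and G: "convex_on UNIV G" and h: "GDERIV h (\<Phi> X) :> d"
    and U: "open U" "\<Phi> X \<in> U"
    and min: "\<And>Z. \<Phi> Z \<in> U \<Longrightarrow> h (\<Phi> X) + G X - V \<bullet> X \<le> h (\<Phi> Z) + G Z - V \<bullet> Z"
  shows "V - adjoint \<Phi> d \<in> subdifferential G X"
  unfolding subdifferential_def
proof (intro CollectI allI)
  fix Z
  interpret \<Phi>: linear \<Phi> by (fact \<Phi>)
  define D where "D = Z - X"
  define q where "q t = h (\<Phi> X + t *\<^sub>R \<Phi> D)" for t
  have line: "((\<lambda>t. \<Phi> X + t *\<^sub>R \<Phi> D) has_derivative (\<lambda>s. s *\<^sub>R \<Phi> D)) (at 0)"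
    by (auto intro!: derivative_eq_intros)
  have "(q has_real_derivative \<Phi> D \<bullet> d) (at 0)"
    using has_derivative_compose[OF line, of h "\<lambda>v. v \<bullet> d"] h
    unfolding gderiv_def q_def[abs_def]
    by (intro has_derivative_imp_has_field_derivative[where D = "\<lambda>s. (s *\<^sub>R \<Phi> D) \<bullet> d"]) simp_all
  then have "((\<lambda>t. (q t - q 0) / t) \<longlongrightarrow> \<Phi> D \<bullet> d) (at 0)"
    by (simp add: has_field_derivative_iff)
  then have lim: "((\<lambda>t. (q t - q 0) / t) \<longlongrightarrow> \<Phi> D \<bullet> d) (at_right 0)"
    by (rule tendsto_mono[rotated]) (simp add: at_le)
  have "((\<lambda>t. \<Phi> X + t *\<^sub>R \<Phi> D) \<longlongrightarrow> \<Phi> X + 0 *\<^sub>R \<Phi> D) (at_right 0)"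
    by (intro tendsto_intros)
  then have "\<forall>\<^sub>F t in at_right 0. \<Phi> X + t *\<^sub>R \<Phi> D \<in> U"
    using U by (intro topological_tendstoD) auto
  moreover have "\<forall>\<^sub>F t in at_right (0::real). 0 < t \<and> t < 1"
    using eventually_at_right_less[of "0::real"] eventually_at_right_field[of "\<lambda>t. t < 1" "0::real"]
    by (auto intro!: eventually_conj exI[of _ 1])
  ultimately have "\<forall>\<^sub>F t in at_right 0. V \<bullet> D - (G Z - G X) \<le> (q t - q 0) / t"
  proof eventually_elim
    case (elim t)
    have "\<Phi> (X + t *\<^sub>R D) = \<Phi> X + t *\<^sub>R \<Phi> D"
      by (simp add: \<Phi>.add \<Phi>.scaleR)
    then have "q 0 + G X - V \<bullet> X \<le> q t + G (X + t *\<^sub>R D) - V \<bullet> (X + t *\<^sub>R D)"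
      using min[of "X + t *\<^sub>R D"] elim by (simp add: q_def)
    moreover have "G (X + t *\<^sub>R D) \<le> (1 - t) * G X + t * G Z"
      using convex_onD[OF G, of t X Z] elim by (simp add: D_def algebra_simps)
    ultimately have "t * (V \<bullet> D - (G Z - G X)) \<le> q t - q 0"
      by (simp add: inner_add_right algebra_simps)
    then show ?case
      using elim by (simp add: field_simps)
  qed
  then have "V \<bullet> D - (G Z - G X) \<le> \<Phi> D \<bullet> d"
    by (intro tendsto_lowerbound[OF lim]) auto
  also have "\<Phi> D \<bullet> d = adjoint \<Phi> d \<bullet> D"
    by (simp add: adjoint_works[OF \<Phi>] inner_commute)
  finally show "G X + (V - adjoint \<Phi> d) \<bullet> (Z - X) \<le> G Z"
    by (simp add: D_def inner_diff_left)
qed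

text \<open>
  On the sphere of radius \<open>e\<close> the values of \<open>\<psi>\<close> exceed \<open>\<psi> x\<close> by a positive gap, by compactness and
  uniqueness. A tilt by less than \<open>\<delta>\<close>, the gap divided by \<open>e\<close>, cannot close this gap, and convexity
  carries the strict inequality over to all points outside of the ball. The minimum over the compact ball is thus
  a global one.
\<close>

lemma tilted_argmin_near:
  fixes \<psi> :: "'a::euclidean_space \<Rightarrow> ereal"
  assumes conv: "convex_fun \<psi>" and uniq: "argmin \<psi> = {x}" and e: "0 < e"
    and p: "\<And>z. z \<in> cball x e \<Longrightarrow> \<psi> z = ereal (p z)" and cont: "continuous_on (cball x e) p"
  obtains \<delta> where "0 < \<delta>" "\<And>V. norm V < \<delta> \<Longrightarrow> argmin (\<lambda>z. \<psi> z - ereal (V \<bullet> z)) \<noteq> {}"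
    "\<And>V. norm V < \<delta> \<Longrightarrow> argmin (\<lambda>z. \<psi> z - ereal (V \<bullet> z)) \<subseteq> ball x e"
proof -
  have x_min: "\<psi> x \<le> \<psi> z" for z
    using uniq mem_argmin_iff[of x \<psi>] by simp
  have px: "\<psi> x = ereal (p x)" using p[of x] e by simp
  have "continuous_on (sphere x e) p"
    by (rule continuous_on_subset[OF cont]) auto
  moreover have "sphere x e \<noteq> {}" using e by simp
  ultimately obtain w where w: "w \<in> sphere x e" and w_min: "\<And>z. z \<in> sphere x e \<Longrightarrow> p w \<le> p z"
    using continuous_attains_inf[of "sphere x e" p] by auto
  have "p x < p w"
  proof (rule ccontr)
    assume "\<not> p x < p w"
    then have "\<psi> w \<le> \<psi> x" using p[of w] w px by simp
    then have "\<psi> w \<le> \<psi> z" for z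
      using order_trans[OF _ x_min[of z]] by blast
    then have "w \<in> argmin \<psi>" by (simp add: mem_argmin_iff)
    then show False using uniq w e by simp
  qed
  define \<delta> where "\<delta> = (p w - p x) / e"
  have sphere: "p x - V \<bullet> x < p z - V \<bullet> z" if "norm V < \<delta>" "z \<in> sphere x e" for V z
  proof -
    have "V \<bullet> (z - x) \<le> norm V * norm (z - x)" by (rule norm_cauchy_schwarz)
    also have "\<dots> = norm V * e" using that(2) by (simp add: dist_norm norm_minus_commute)
    also have "\<dots> < p w - p x" using that(1) e by (simp add: \<delta>_def field_simps)
    finally show ?thesis using w_min[OF that(2)] by (simp add: inner_diff_right)
  qed
  \<comment> \<open>By convexity along the segment from \<open>x\<close>, a value that is small outside of the ball would
    give a small value on its boundary.\<close>
  have outside: "\<psi> x - ereal (V \<bullet> x) < \<psi> z - ereal (V \<bullet> z)" if V: "norm V < \<delta>" and z: "z \<notin> ball x e" for V z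
  proof (rule ccontr)
    assume "\<not> ?thesis"
    then have le: "\<psi> z - ereal (V \<bullet> z) \<le> ereal (p x - V \<bullet> x)"
      by (simp add: px)
    then obtain r where r: "\<psi> z = ereal r"
      using x_min[of z] px by (cases "\<psi> z") auto
    define t where "t = e / dist x z"
    have "e \<le> dist x z" "0 < dist x z" using z e by (auto simp: not_less intro: less_le_trans)
    then have t: "0 < t" "t \<le> 1" using e by (auto simp: t_def)
    define u where "u = (1 - t) *\<^sub>R x + t *\<^sub>R z"
    have "x - u = t *\<^sub>R (x - z)" by (simp add: u_def algebra_simps)
    then have "dist x u = e"
      using t(1) \<open>0 < dist x z\<close> e by (simp add: dist_norm t_def)
    then have u: "u \<in> sphere x e" by simp
    have "\<psi> u \<le> ereal ((1 - t) * p x + t * r)"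
    proof (cases "t = 1")
      case True then show ?thesis by (simp add: u_def r)
    next
      case False
      then have "\<psi> u \<le> ereal (1 - t) * \<psi> x + ereal t * \<psi> z"
        using conv t unfolding convex_fun_def u_def by simp
      then show ?thesis by (simp add: px r)
    qed
    then have "p u \<le> (1 - t) * p x + t * r"
      using p[of u] u by simp
    moreover have "V \<bullet> u = (1 - t) * (V \<bullet> x) + t * (V \<bullet> z)"
      by (simp add: u_def inner_add_right)
    moreover have "t * (r - V \<bullet> z) \<le> t * (p x - V \<bullet> x)"
      using le r t by (intro mult_left_mono) auto
    ultimately have "p u - V \<bullet> u \<le> p x - V \<bullet> x"
      by (simp add: algebra_simps)
    then show False using sphere[OF V u] by simp
  qed
  show ?thesis
  proof (rule that[of \<delta>])
    show "0 < \<delta>" using \<open>p x < p w\<close> e by (simp add: \<delta>_def)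
    fix V :: 'a assume V: "norm V < \<delta>"
    let ?\<theta> = "\<lambda>z. \<psi> z - ereal (V \<bullet> z)"
    show "argmin ?\<theta> \<subseteq> ball x e"
      using outside[OF V] by (force simp: mem_argmin_iff not_le[symmetric])
    have "continuous_on (cball x e) (\<lambda>z. p z - V \<bullet> z)"
      by (intro continuous_intros cont)
    then obtain m where m: "m \<in> cball x e" "\<And>z. z \<in> cball x e \<Longrightarrow> p m - V \<bullet> m \<le> p z - V \<bullet> z"
      using continuous_attains_inf[of "cball x e" "\<lambda>z. p z - V \<bullet> z"] e by auto
    have "?\<theta> m \<le> ?\<theta> z" for z
    proof (cases "z \<in> cball x e")
      case True then show ?thesis using m p by simp
    next
      case False
      then have "?\<theta> x < ?\<theta> z" by (intro outside[OF V]) auto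
      moreover have "?\<theta> m \<le> ?\<theta> x" using m(1) m(2)[of x] p[of m] px e by simp
      ultimately show ?thesis by simp
    qed
    then show "argmin ?\<theta> \<noteq> {}" using mem_argmin_iff[of m ?\<theta>] by blast
  qed
qed

lemma convex_fun_objective:
  fixes \<Phi> :: "real^'n2^'n1 \<Rightarrow> real^'m"
  assumes f: "proper_fun f" "convex_fun f" and \<Phi>: "linear \<Phi>"
  shows "convex_fun (objective f \<Phi>)"
  unfolding convex_fun_def
proof (intro allI impI, elim conjE)
  fix X Z :: "real^'n2^'n1" and t :: real assume t: "0 < t" "t < 1"
  interpret \<Phi>: linear \<Phi> by (fact \<Phi>)
  let ?W = "(1 - t) *\<^sub>R X + t *\<^sub>R Z"
  have "f (\<Phi> ?W) \<le> ereal (1 - t) * f (\<Phi> X) + ereal t * f (\<Phi> Z)"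
    using f(2) t by (simp add: convex_fun_def \<Phi>.add \<Phi>.scaleR)
  moreover have "nuclear_norm ?W \<le> (1 - t) * nuclear_norm X + t * nuclear_norm Z"
    using convex_onD[OF convex_nuclear_norm, of t X Z] t by simp
  moreover have "f (\<Phi> X) \<noteq> -\<infinity>" "f (\<Phi> Z) \<noteq> -\<infinity>" "f (\<Phi> ?W) \<noteq> -\<infinity>"
    using f(1) by (auto simp: proper_fun_def)
  ultimately show "objective f \<Phi> ?W \<le> ereal (1 - t) * objective f \<Phi> X + ereal t * objective f \<Phi> Z"
    using t unfolding objective_def
    by (cases "f (\<Phi> X)"; cases "f (\<Phi> Z)"; cases "f (\<Phi> ?W)") (auto simp: algebra_simps)
qed

section \<open>Tilt stability\<close>

theorem corollary3p10:
  fixes \<Phi> :: "real^'n2^'n1 \<Rightarrow> real^'m"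
    and f :: "real^'m \<Rightarrow> ereal"
    and Xbar Ybar :: "real^'n2^'n1"
  assumes "CARD('n1) \<le> CARD('n2)"
    and "linear \<Phi>"
    and "proper_fun f" and "lsc_fun f" and "convex_fun f"
    and "twice_continuously_differentiable_on (\<lambda>y. real_of_ereal (f y)) (interior (edom f))"
    and "\<And>y. y \<in> interior (edom f) \<Longrightarrow> positive_definite (hessian (\<lambda>y. real_of_ereal (f y)) y)"
    and "Xbar \<in> \<Phi> -` interior (edom f)"
    and "Xbar \<in> argmin (objective f \<Phi>)"
    and "Ybar = - adjoint \<Phi> (gradient (\<lambda>y. real_of_ereal (f y)) (\<Phi> Xbar))"
    and nondegeneracy: "Ybar \<in> rel_interior (subdifferential nuclear_norm Xbar)"
  shows "tilt_stable f \<Phi> Xbar \<longleftrightarrow> argmin (objective f \<Phi>) = {Xbar}"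
proof
  assume "tilt_stable f \<Phi> Xbar"
  then have "tilted_solutions f \<Phi> 0 = {Xbar}"
    by (simp add: tilt_stable_def)
  then show "argmin (objective f \<Phi>) = {Xbar}"
    by (simp add: tilted_solutions_def zero_ereal_def[symmetric])
next
  assume uniq: "argmin (objective f \<Phi>) = {Xbar}"
  interpret \<Phi>: linear \<Phi> by (fact \<open>linear \<Phi>\<close>)
  interpret adj: linear "adjoint \<Phi>" by (rule adjoint_linear[OF \<open>linear \<Phi>\<close>])
  define U where "U = interior (edom f)"
  define h where "h y = real_of_ereal (f y)" for y
  let ?G = "nuclear_norm :: real^'n2^'n1 \<Rightarrow> real"
  let ?S = "tilted_solutions f \<Phi>"
  have U: "open U" "\<Phi> Xbar \<in> U"
    using assms(8) by (auto simp: U_def)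
  have h: "twice_continuously_differentiable_on h U"
    using assms(6) by (simp add: h_def[abs_def] U_def)
  have h_diff: "h differentiable (at y)" and grad_diff: "gradient h differentiable (at y)"
    if "y \<in> U" for y
    using h that by (simp_all add: twice_continuously_differentiable_on_def)
  have f_eq: "f y = ereal (h y)" if "y \<in> U" for y
  proof -
    have "f y < \<infinity>"
      using that interior_subset by (auto simp: U_def edom_def)
    moreover have "f y \<noteq> -\<infinity>"
      using \<open>proper_fun f\<close> by (simp add: proper_fun_def)
    ultimately show ?thesis
      by (cases "f y") (auto simp: h_def)
  qed
  have obj: "objective f \<Phi> X = ereal (h (\<Phi> X) + ?G X)" if "\<Phi> X \<in> U" for X
    using f_eq[OF that] by (simp add: objective_def)
  have Ybar: "Ybar = - adjoint \<Phi> (gradient h (\<Phi> Xbar))"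
    using assms(10) by (simp add: h_def[abs_def])
  have sub: "Ybar \<in> subdifferential ?G Xbar"
    using nondegeneracy rel_interior_subset by blast
  then have cYbar: "contraction Ybar"
    by (simp add: subdifferential_nuclear_norm_iff)

  \<comment> \<open>Along a direction \<open>W\<close> in both subspaces, \<open>f \<circ> \<Phi>\<close> is constant and \<open>G\<close> has the slope
    \<open>\<langle>Ybar, W\<rangle> = 0\<close>, so the objective value does not change.\<close>
  have ker: "W = 0" if W: "W \<in> normal_cone_span Ybar" "\<Phi> W = 0" for W
  proof -
    obtain t where t: "0 < t" "Ybar \<in> subdifferential ?G (Xbar + t *\<^sub>R W)"
      using nondegenerate_subgradient_persists[OF nondegeneracy W(1)] by blast
    let ?Xt = "Xbar + t *\<^sub>R W"
    have \<Phi>t: "\<Phi> ?Xt = \<Phi> Xbar"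
      by (simp add: \<Phi>.add \<Phi>.scaleR W(2))
    have "Ybar \<bullet> W = 0"
      using adjoint_works[OF \<open>linear \<Phi>\<close>, of W] by (simp add: Ybar inner_commute W(2))
    then have "?G ?Xt = ?G Xbar"
      using sub t(2) by (simp add: subdifferential_nuclear_norm_iff inner_add_right)
    then have "objective f \<Phi> ?Xt = objective f \<Phi> Xbar"
      by (simp add: objective_def \<Phi>t)
    then have "?Xt \<in> argmin (objective f \<Phi>)"
      using assms(9) by (simp add: mem_argmin_iff)
    then show "W = 0" using uniq t(1) by simp
  qed

  obtain \<kappa> \<eta> where \<kappa>: "0 < \<kappa>" and \<eta>: "0 < \<eta>"
    and modulus: "\<And>X1 X2 Y1 Y2. Y1 \<in> subdifferential ?G X1 \<Longrightarrow> Y2 \<in> subdifferential ?G X2 \<Longrightarrow>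
      norm (Y1 - Ybar) \<le> \<eta> \<Longrightarrow> ?G X2 \<le> ?G Xbar + 1 \<Longrightarrow>
      \<kappa> * (norm (X1 - X2))\<^sup>2 \<le> (norm (\<Phi> (X1 - X2)))\<^sup>2 + (Y1 - Y2) \<bullet> (X1 - X2)"
    using subgradient_monotonicity_modulus[OF \<open>linear \<Phi>\<close> cYbar ker, of "?G Xbar + 1"] by metis
  have "positive_definite (hessian h (\<Phi> Xbar))"
    using assms(7) U(2) by (simp add: h_def[abs_def] U_def)
  then obtain \<mu> \<rho> where \<mu>: "0 < \<mu>" and \<rho>: "0 < \<rho>" "ball (\<Phi> Xbar) \<rho> \<subseteq> U"
    and strong: "\<And>u v. u \<in> ball (\<Phi> Xbar) \<rho> \<Longrightarrow> v \<in> ball (\<Phi> Xbar) \<rho> \<Longrightarrow>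
      \<mu> * (norm (u - v))\<^sup>2 \<le> (gradient h u - gradient h v) \<bullet> (u - v)"
    using gradient_strongly_monotone_near[OF U(1) h U(2)] by metis

  define grad where "grad X = adjoint \<Phi> (gradient h (\<Phi> X))" for X
  have "isCont \<Phi> Xbar"
    using \<open>linear \<Phi>\<close> by (simp add: linear_continuous_at linear_linear)
  moreover have "isCont grad Xbar"
  proof -
    have "isCont (gradient h) (\<Phi> Xbar)"
      using grad_diff[OF U(2)] by (rule differentiable_imp_continuous_within)
    from isCont_o2[OF \<open>isCont \<Phi> Xbar\<close> this]
    have "isCont (\<lambda>X. gradient h (\<Phi> X)) Xbar" .
    moreover have "isCont (adjoint \<Phi>) (gradient h (\<Phi> Xbar))"
      using adj.linear_axioms by (simp add: linear_continuous_at linear_linear)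
    ultimately show ?thesis
      unfolding grad_def by (rule isCont_o2)
  qed
  moreover have "isCont ?G Xbar"
    using continuous_nuclear_norm continuous_on_eq_continuous_at[OF open_UNIV] by blast
  ultimately have "\<forall>\<^sub>F X in nhds Xbar. dist (\<Phi> X) (\<Phi> Xbar) < \<rho> \<and> dist (grad X) (grad Xbar) < \<eta> / 2 \<and>
      dist (?G X) (?G Xbar) < 1"
    using \<rho>(1) half_gt_zero[OF \<eta>] zero_less_one unfolding isCont_def tendsto_iff eventually_nhds_conv_at
    by (intro conjI eventually_conj) (blast, blast, blast, simp_all)
  then obtain d where d: "0 < d" "\<And>X. dist X Xbar < d \<Longrightarrow> dist (\<Phi> X) (\<Phi> Xbar) < \<rho> \<and>
      dist (grad X) (grad Xbar) < \<eta> / 2 \<and> dist (?G X) (?G Xbar) < 1"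
    by (auto simp: eventually_nhds_metric)
  define e where "e = d / 2"
  have "0 < e" using d(1) by (simp add: e_def)
  have near: "\<Phi> X \<in> ball (\<Phi> Xbar) \<rho>" "norm (grad X - grad Xbar) < \<eta> / 2" "?G X \<le> ?G Xbar + 1"
    if "X \<in> cball Xbar e" for X
    using d(2)[of X] that d(1) by (auto simp: e_def dist_commute dist_norm dist_real_def)
  then have nearU: "\<Phi> X \<in> U" if "X \<in> cball Xbar e" for X
    using \<rho>(2) that by blast

  \<comment> \<open>Near \<open>Xbar\<close> the objective is finite and continuous, as the localization of minimizers requires.\<close>
  have "continuous_on U h"
    using h_diff by (meson continuous_at_imp_continuous_on differentiable_imp_continuous_within)
  moreover have "continuous_on (cball Xbar e) \<Phi>"
    using \<open>linear \<Phi>\<close> by (simp add: linear_continuous_on linear_linear)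
  moreover have "\<Phi> ` cball Xbar e \<subseteq> U"
    using nearU by blast
  ultimately have "continuous_on (cball Xbar e) (\<lambda>X. h (\<Phi> X))"
    by (rule continuous_on_compose2)
  then have cont: "continuous_on (cball Xbar e) (\<lambda>X. h (\<Phi> X) + ?G X)"
    by (intro continuous_on_add continuous_nuclear_norm)
  have conv: "convex_fun (objective f \<Phi>)"
    using \<open>proper_fun f\<close> \<open>convex_fun f\<close> \<open>linear \<Phi>\<close> by (rule convex_fun_objective)
  obtain \<delta> where \<delta>: "0 < \<delta>" "\<And>V. norm V < \<delta> \<Longrightarrow> ?S V \<noteq> {}" "\<And>V. norm V < \<delta> \<Longrightarrow> ?S V \<subseteq> ball Xbar e"
    unfolding tilted_solutions_def
    using tilted_argmin_near[OF conv uniq \<open>0 < e\<close> obj[OF nearU] cont] by blast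

  have optimal: "V - grad X \<in> subdifferential ?G X" if X: "X \<in> ?S V" "X \<in> cball Xbar e" for V X
    unfolding grad_def
  proof (rule composite_minimizer_subgradient[OF \<open>linear \<Phi>\<close> convex_nuclear_norm _ U(1)])
    show "GDERIV h (\<Phi> X) :> gradient h (\<Phi> X)"
      by (intro GDERIV_gradient h_diff nearU X)
    show "\<Phi> X \<in> U" by (intro nearU X)
    fix Z assume "\<Phi> Z \<in> U"
    moreover have "objective f \<Phi> X - ereal (V \<bullet> X) \<le> objective f \<Phi> Z - ereal (V \<bullet> Z)"
      using X(1) unfolding tilted_solutions_def mem_argmin_iff by blast
    ultimately show "h (\<Phi> X) + ?G X - V \<bullet> X \<le> h (\<Phi> Z) + ?G Z - V \<bullet> Z"
      using \<open>\<Phi> X \<in> U\<close> by (simp add: obj)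
  qed

  define L where "L = 1 / (min \<mu> 1 * \<kappa>)"
  \<comment> \<open>Half of \<open>\<eta>\<close> is spent on the tilt and the other half on the variation of the gradient, so that
    \<open>V - grad X\<close> stays within \<open>\<eta>\<close> of \<open>Ybar\<close>.\<close>
  define N where "N = ball (0 :: real^'n2^'n1) (min \<delta> (\<eta> / 2))"
  have lipschitz: "norm (X1 - X2) \<le> L * norm (V1 - V2)"
    if V: "V1 \<in> N" "V2 \<in> N" and S: "X1 \<in> ?S V1" "X2 \<in> ?S V2" for V1 V2 X1 X2
  proof -
    have X: "X1 \<in> cball Xbar e" "X2 \<in> cball Xbar e"
      using V S \<delta>(3)[of V1] \<delta>(3)[of V2] by (auto simp: N_def)
    define Y1 Y2 where "Y1 = V1 - grad X1" and "Y2 = V2 - grad X2"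
    have Y: "Y1 \<in> subdifferential ?G X1" "Y2 \<in> subdifferential ?G X2"
      using optimal S X by (simp_all add: Y1_def Y2_def)
    have "Y1 - Ybar = V1 - (grad X1 - grad Xbar)"
      by (simp add: Y1_def Ybar grad_def)
    then have "norm (Y1 - Ybar) \<le> \<eta>"
      using norm_triangle_ineq4[of V1 "grad X1 - grad Xbar"] near(2)[OF X(1)] V(1)
      by (simp add: N_def)
    note mod = modulus[OF Y this near(3)[OF X(2)]]
    have mono: "0 \<le> (Y1 - Y2) \<bullet> (X1 - X2)"
      using Y by (auto simp: subdifferential_nuclear_norm_iff inner_diff_left inner_diff_right
          dest!: inner_contraction_le_nuclear_norm[of Y1 X2] inner_contraction_le_nuclear_norm[of Y2 X1])
    have "min \<mu> 1 * (\<kappa> * (norm (X1 - X2))\<^sup>2) \<le>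
        min \<mu> 1 * ((norm (\<Phi> (X1 - X2)))\<^sup>2 + (Y1 - Y2) \<bullet> (X1 - X2))"
      using mod \<mu> by (intro mult_left_mono) auto
    also have "\<dots> \<le> \<mu> * (norm (\<Phi> (X1 - X2)))\<^sup>2 + 1 * ((Y1 - Y2) \<bullet> (X1 - X2))"
      unfolding distrib_left using mono by (intro add_mono mult_right_mono) auto
    also have "\<dots> \<le> (gradient h (\<Phi> X1) - gradient h (\<Phi> X2)) \<bullet> \<Phi> (X1 - X2) + (Y1 - Y2) \<bullet> (X1 - X2)"
      using strong[OF near(1)[OF X(1)] near(1)[OF X(2)]] by (simp add: \<Phi>.diff)
    also have "\<dots> = (grad X1 - grad X2) \<bullet> (X1 - X2) + (Y1 - Y2) \<bullet> (X1 - X2)"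
      using adjoint_works[OF \<open>linear \<Phi>\<close>, of "X1 - X2" "gradient h (\<Phi> X1) - gradient h (\<Phi> X2)"]
      by (simp add: grad_def adj.diff inner_commute)
    also have "\<dots> = (V1 - V2) \<bullet> (X1 - X2)"
      by (simp add: Y1_def Y2_def inner_diff_left)
    also have "\<dots> \<le> norm (V1 - V2) * norm (X1 - X2)"
      by (rule norm_cauchy_schwarz)
    finally have "norm (X1 - X2) * (min \<mu> 1 * \<kappa> * norm (X1 - X2)) \<le> norm (X1 - X2) * norm (V1 - V2)"
      by (simp add: power2_eq_square mult_ac)
    then have "min \<mu> 1 * \<kappa> * norm (X1 - X2) \<le> norm (V1 - V2)"
      by (cases "X1 = X2") (auto simp: mult_le_cancel_left)
    then show ?thesis
      using \<mu> \<kappa> by (simp add: L_def field_simps)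
  qed

  define s where "s V = (SOME X. X \<in> ?S V)" for V
  have s: "s V \<in> ?S V" if "V \<in> N" for V
    using \<delta>(2)[of V] that by (auto simp: N_def s_def some_in_eq)
  have "?S V = {s V}" if "V \<in> N" for V
    using s[OF that] lipschitz[OF that that] by fastforce
  moreover have "L-lipschitz_on N s"
    using lipschitz s \<mu> \<kappa> by (intro lipschitz_onI) (auto simp: dist_norm L_def)
  moreover have "open N" "0 \<in> N"
    using \<delta>(1) \<eta> by (auto simp: N_def)
  moreover have "?S 0 = {Xbar}"
    using uniq by (simp add: tilted_solutions_def zero_ereal_def[symmetric])
  ultimately show "tilt_stable f \<Phi> Xbar"
    unfolding tilt_stable_def by blast
qed

end
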